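(* Let $M$ be a unital $C^*$-algebra and let $\alpha$ be an action of a finite group $G$ on $M$, with identity element $\iota\in G$. Let $E:M\to M^\alpha$, $E(x)=\frac1{|G|}\sum_{g\in G}\alpha_g(x)$, be the canonical conditional expectation onto the fixed point algebra. Then the following are equivalent: (i) $\alpha$ is saturated, that is, $\mathcal J_\alpha=M\times_\alpha G$. (ii) $E:M\to M^\alpha$ is of index-finite type with $Index(E)=|G|$. (iii) $E:M\to M^\alpha$ is of index-finite type with $Index(E)=|G|$, and $\sum_i u_i\alpha_g(u_i^* )=0$ for all $g\neq\iota$, for a quasi-basis $\{(u_i,u_i^* )\}$ for $E$. (iv) There exist $\{b^j_g\in M\mid g\in G,\ 1\le j\le m\}$ for some $m\ge1$ such that (a) $\alpha_g(b^j_h)=b^j_{gh}$ for $j=1,\dots,m$ and $g,h\in G$; (b) $\sum_j b^j_g(b^j_h)^*=\delta_{gh}$ for $g,h\in G$. (v) For every $\varepsilon>0$ there exist $\{b^j_g\in M\mid g\in G,\ 1\le j\le m\}$ for some $m\ge1$ such that, for all $g,h\in G$, (a) $\sum_j\|\alpha_g(b^j_h)-b^j_{gh}\|<\varepsilon$; (b) $\big\|\sum_j b^j_g(b^j_h)^*-\delta_{gh}\big\|<\varepsilon$.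
   Context: $M^\alpha=\{x\in M\mid\alpha_g(x)=x\text{ for all }g\in G\}$. $M\times_\alpha G=\mathrm{span}\{x\lambda_g\mid x\in M,g\in G\}$ is the usual crossed product $C^*$-algebra, where the $\lambda_g$ are the implementing unitaries, $\lambda_gx\lambda_g^*=\alpha_g(x)$. $\mathcal J_\alpha$ denotes the closed two-sided ideal of $M\times_\alpha G$ generated by the projection $e=\frac1{|G|}\sum_{g\in G}\lambda_g$, and $\alpha$ is called saturated if $\mathcal J_\alpha=M\times_\alpha G$. $\delta_{gh}$ is the Kronecker delta, i.e. $1$ (the unit of $M$) if $g=h$ and $0$ otherwise; $|G|$ in $Index(E)=|G|$ denotes $|G|\cdot1_M$. A faithful conditional expectation $E:B\to C$ from a unital $C^*$-algebra $B$ onto a $C^*$-subalgebra $C$ containing the unit of $B$ is of index-finite type if there are finitely many $v_1,\dots,v_n\in B$ with $b=\sum_iE(bv_i)v_i^*=\sum_iv_iE(v_i^*b)$ for all $b\in B$; then $\{(v_i,v_i^* )\}$ is called a quasi-basis for $E$, and $Index(E)=\sum_iv_iv_i^*$, which is a central element of $B$ independent of the choice of quasi-basis. *)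

theory Defs
  imports
    Complex_Main
    "HOL-Library.Function_Algebras"
    "HOL-Algebra.Group_Action"
begin

section \<open>Unital C*-algebras\<close>

text \<open>
  The whole type is the algebra.  As usual for unital Banach algebras, the class
  \<^class>\<open>real_normed_algebra_1\<close> includes \<open>1 \<noteq> 0\<close> and \<open>norm 1 = 1\<close>.
\<close>

class unital_cstar_algebra = real_normed_algebra_1 + banach +
  fixes scaleC :: "complex \<Rightarrow> 'a \<Rightarrow> 'a"  (infixr \<open>*\<^sub>C\<close> 75)
    and star :: "'a \<Rightarrow> 'a"  (\<open>(_\<^sup>\<star>)\<close> [1000] 999)
  assumes scaleC_add_right: "c *\<^sub>C (x + y) = c *\<^sub>C x + c *\<^sub>C y"
    and scaleC_add_left: "(c + d) *\<^sub>C x = c *\<^sub>C x + d *\<^sub>C x"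
    and scaleC_scaleC: "c *\<^sub>C (d *\<^sub>C x) = (c * d) *\<^sub>C x"
    and scaleC_of_real: "complex_of_real r *\<^sub>C x = r *\<^sub>R x"
    and scaleC_mult_left: "(c *\<^sub>C x) * y = c *\<^sub>C (x * y)"
    and scaleC_mult_right: "x * (c *\<^sub>C y) = c *\<^sub>C (x * y)"
    and norm_scaleC: "norm (c *\<^sub>C x) = cmod c * norm x"
    and star_add: "(x + y)\<^sup>\<star> = x\<^sup>\<star> + y\<^sup>\<star>"
    and star_scaleC: "(c *\<^sub>C x)\<^sup>\<star> = cnj c *\<^sub>C x\<^sup>\<star>"
    and star_mult: "(x * y)\<^sup>\<star> = y\<^sup>\<star> * x\<^sup>\<star>"
    and star_star: "(x\<^sup>\<star>)\<^sup>\<star> = x"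
    and cstar_identity: "norm (x\<^sup>\<star> * x) = (norm x)\<^sup>2"

lemma vector_space_scaleC: "vector_space (scaleC :: complex \<Rightarrow> 'a \<Rightarrow> 'a::unital_cstar_algebra)"
  using scaleC_of_real[where r = 1]
  by unfold_locales (simp_all add: scaleC_add_right scaleC_add_left scaleC_scaleC)

definition positive_element :: "'a::unital_cstar_algebra \<Rightarrow> bool" where
  "positive_element a \<longleftrightarrow> (\<exists>x. a = x\<^sup>\<star> * x)"

definition unital_cstar_subalgebra :: "'a::unital_cstar_algebra set \<Rightarrow> bool" where
  "unital_cstar_subalgebra C \<longleftrightarrow>
     module.subspace (*\<^sub>C) C \<and> 1 \<in> C \<and>
     (\<forall>x\<in>C. \<forall>y\<in>C. x * y \<in> C) \<and> (\<forall>x\<in>C. x\<^sup>\<star> \<in> C) \<and> closed C"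

definition star_homomorphism ::
    "('a::unital_cstar_algebra \<Rightarrow> 'b::unital_cstar_algebra) \<Rightarrow> bool" where
  "star_homomorphism f \<longleftrightarrow>
     Vector_Spaces.linear (*\<^sub>C) (*\<^sub>C) f \<and>
     (\<forall>x y. f (x * y) = f x * f y) \<and> (\<forall>x. f (x\<^sup>\<star>) = (f x)\<^sup>\<star>)"

section \<open>Conditional expectations and their index\<close>

definition conditional_expectation ::
    "'a::unital_cstar_algebra set \<Rightarrow> ('a \<Rightarrow> 'a) \<Rightarrow> bool" where
  "conditional_expectation C E \<longleftrightarrow>
     unital_cstar_subalgebra C \<and>
     Vector_Spaces.linear (*\<^sub>C) (*\<^sub>C) E \<and>
     range E = C \<and> (\<forall>c\<in>C. E c = c) \<and>
     (\<forall>c\<in>C. \<forall>x. E (c * x) = c * E x \<and> E (x * c) = E x * c) \<and>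
     (\<forall>x. positive_element (E (x\<^sup>\<star> * x)))"

definition faithful_conditional_expectation ::
    "'a::unital_cstar_algebra set \<Rightarrow> ('a \<Rightarrow> 'a) \<Rightarrow> bool" where
  "faithful_conditional_expectation C E \<longleftrightarrow>
     conditional_expectation C E \<and> (\<forall>x. E (x\<^sup>\<star> * x) = 0 \<longrightarrow> x = 0)"

definition quasi_basis ::
    "('a::unital_cstar_algebra \<Rightarrow> 'a) \<Rightarrow> nat \<Rightarrow> (nat \<Rightarrow> 'a) \<Rightarrow> bool" where
  "quasi_basis E n v \<longleftrightarrow>
     (\<forall>b. b = (\<Sum>i=1..n. E (b * v i) * (v i)\<^sup>\<star>) \<and> b = (\<Sum>i=1..n. v i * E ((v i)\<^sup>\<star> * b)))"

definition index_finite_type ::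
    "'a::unital_cstar_algebra set \<Rightarrow> ('a \<Rightarrow> 'a) \<Rightarrow> bool" where
  "index_finite_type C E \<longleftrightarrow>
     faithful_conditional_expectation C E \<and> (\<exists>n v. quasi_basis E n v)"

definition Index :: "('a::unital_cstar_algebra \<Rightarrow> 'a) \<Rightarrow> 'a" where
  "Index E = (THE z. \<exists>n v. quasi_basis E n v \<and> z = (\<Sum>i=1..n. v i * (v i)\<^sup>\<star>))"

lemma quasi_basis_sum_unique:
  assumes v: "quasi_basis E n v" and w: "quasi_basis E m w"
  shows "(\<Sum>i=1..n. v i * (v i)\<^sup>\<star>) = (\<Sum>j=1..m. w j * (w j)\<^sup>\<star>)"
proof -
  have "(\<Sum>i=1..n. v i * (v i)\<^sup>\<star>)
      = (\<Sum>i=1..n. (\<Sum>j=1..m. w j * E ((w j)\<^sup>\<star> * v i)) * (v i)\<^sup>\<star>)"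
    using w unfolding quasi_basis_def by metis
  also have "\<dots> = (\<Sum>j=1..m. w j * (\<Sum>i=1..n. E ((w j)\<^sup>\<star> * v i) * (v i)\<^sup>\<star>))"
    unfolding sum_distrib_left sum_distrib_right mult.assoc by (rule sum.swap)
  also have "\<dots> = (\<Sum>j=1..m. w j * (w j)\<^sup>\<star>)"
    using v unfolding quasi_basis_def by metis
  finally show ?thesis .
qed

lemma Index_eq:
  assumes "quasi_basis E n v"
  shows "Index E = (\<Sum>i=1..n. v i * (v i)\<^sup>\<star>)"
  unfolding Index_def using assms quasi_basis_sum_unique by (intro the_equality) blast+

section \<open>Actions of groups on C*-algebras\<close>

text \<open>
  \<open>group_action G UNIV \<alpha>\<close> says that \<open>G\<close> is a group and \<open>\<alpha>\<close> is a homomorphism from \<open>G\<close> to the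
  group of bijections of the algebra.
\<close>

definition cstar_action :: "('g, 'r) monoid_scheme \<Rightarrow> ('g \<Rightarrow> 'a \<Rightarrow> 'a::unital_cstar_algebra) \<Rightarrow> bool" where
  "cstar_action G \<alpha> \<longleftrightarrow>
     group_action G UNIV \<alpha> \<and> (\<forall>g\<in>carrier G. star_homomorphism (\<alpha> g))"

definition fixed_point_algebra ::
    "('g, 'r) monoid_scheme \<Rightarrow> ('g \<Rightarrow> 'a \<Rightarrow> 'a) \<Rightarrow> 'a::unital_cstar_algebra set" where
  "fixed_point_algebra G \<alpha> = {x. \<forall>g\<in>carrier G. \<alpha> g x = x}"

definition canonical_expectation ::
    "('g, 'r) monoid_scheme \<Rightarrow> ('g \<Rightarrow> 'a \<Rightarrow> 'a) \<Rightarrow> 'a \<Rightarrow> 'a::unital_cstar_algebra" where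
  "canonical_expectation G \<alpha> x = (1 / real (order G)) *\<^sub>R (\<Sum>g\<in>carrier G. \<alpha> g x)"

section \<open>The crossed product by a finite group\<close>

text \<open>
  The crossed product is realised through its regular representation on the right Hilbert module
  \<open>\<ell>\<^sup>2(G, M)\<close>, with inner product \<open>\<langle>\<xi>, \<eta>\<rangle> = \<Sum>h. \<xi>(h)\<^sup>\<star> \<eta>(h)\<close>.  A vector is a function
  on the type of \<open>G\<close> of which only the values on \<open>carrier G\<close> count: all operators below ignore the
  other values and return functions vanishing there.  In particular the unit of the crossed
  product is \<open>reg_rep G \<alpha> 1 = reg_unitary G \<one>\<close>, not the identity function.  Sums of operators are
  pointwise, products are compositions.
\<close>

type_synonym ('g, 'a) operator = "('g \<Rightarrow> 'a) \<Rightarrow> ('g \<Rightarrow> 'a)"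

definition reg_rep ::
    "('g, 'r) monoid_scheme \<Rightarrow> ('g \<Rightarrow> 'a \<Rightarrow> 'a) \<Rightarrow> 'a \<Rightarrow> ('g, 'a::unital_cstar_algebra) operator" where
  "reg_rep G \<alpha> x = (\<lambda>\<xi> h. if h \<in> carrier G then \<alpha> (inv\<^bsub>G\<^esub> h) x * \<xi> h else 0)"

definition reg_unitary ::
    "('g, 'r) monoid_scheme \<Rightarrow> 'g \<Rightarrow> ('g, 'a::unital_cstar_algebra) operator" where
  "reg_unitary G g = (\<lambda>\<xi> h. if h \<in> carrier G then \<xi> (inv\<^bsub>G\<^esub> g \<otimes>\<^bsub>G\<^esub> h) else 0)"

definition op_scaleC ::
    "complex \<Rightarrow> ('g, 'a::unital_cstar_algebra) operator \<Rightarrow> ('g, 'a) operator" where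
  "op_scaleC c T = (\<lambda>\<xi> h. c *\<^sub>C T \<xi> h)"

lemma vector_space_op_scaleC:
  "vector_space (op_scaleC :: complex \<Rightarrow> ('g, 'a::unital_cstar_algebra) operator \<Rightarrow> _)"
  using scaleC_of_real[where r = 1 and 'a = 'a]
  by unfold_locales
    (simp_all add: op_scaleC_def fun_eq_iff scaleC_add_right scaleC_add_left scaleC_scaleC)

definition crossed_product ::
    "('g, 'r) monoid_scheme \<Rightarrow> ('g \<Rightarrow> 'a \<Rightarrow> 'a) \<Rightarrow> ('g, 'a::unital_cstar_algebra) operator set" where
  "crossed_product G \<alpha> =
     module.span op_scaleC {reg_rep G \<alpha> x \<circ> reg_unitary G g | x g. g \<in> carrier G}"

lemma reg_covariance:
  assumes \<alpha>: "cstar_action G \<alpha>" and g: "g \<in> carrier G"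
  shows "reg_unitary G g \<circ> reg_rep G \<alpha> x \<circ> reg_unitary G (inv\<^bsub>G\<^esub> g) = reg_rep G \<alpha> (\<alpha> g x)"
proof -
  have hom: "group_hom G (BijGroup UNIV) \<alpha>"
    using \<alpha> by (simp add: cstar_action_def group_action_def)
  then interpret group G by (simp add: group_hom_def)
  have mult: "\<alpha> (a \<otimes>\<^bsub>G\<^esub> b) y = \<alpha> a (\<alpha> b y)" if "a \<in> carrier G" "b \<in> carrier G" for a b y
    using group_hom.hom_mult[OF hom that] group_hom.hom_closed[OF hom that(1)]
      group_hom.hom_closed[OF hom that(2)]
    by (simp add: BijGroup_def compose_def)
  show ?thesis
    using g by (auto simp: fun_eq_iff reg_unitary_def reg_rep_def mult[symmetric]
        inv_mult_group m_assoc[symmetric])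
qed

definition l2_norm ::
    "('g, 'r) monoid_scheme \<Rightarrow> ('g \<Rightarrow> 'a::unital_cstar_algebra) \<Rightarrow> real" where
  "l2_norm G \<xi> = sqrt (norm (\<Sum>h\<in>carrier G. (\<xi> h)\<^sup>\<star> * \<xi> h))"

definition op_norm ::
    "('g, 'r) monoid_scheme \<Rightarrow> ('g, 'a::unital_cstar_algebra) operator \<Rightarrow> real" where
  "op_norm G T = (SUP \<xi>\<in>{\<xi>. l2_norm G \<xi> \<le> 1}. l2_norm G (T \<xi>))"

definition closed_ideal ::
    "('g, 'r) monoid_scheme \<Rightarrow> ('g \<Rightarrow> 'a \<Rightarrow> 'a) \<Rightarrow> ('g, 'a::unital_cstar_algebra) operator set \<Rightarrow> bool" where
  "closed_ideal G \<alpha> J \<longleftrightarrow>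
     J \<subseteq> crossed_product G \<alpha> \<and> module.subspace op_scaleC J \<and>
     (\<forall>S\<in>crossed_product G \<alpha>. \<forall>T\<in>J. S \<circ> T \<in> J \<and> T \<circ> S \<in> J) \<and>
     (\<forall>T. \<forall>S\<in>crossed_product G \<alpha>.
        (\<forall>n. T n \<in> J) \<and> (\<lambda>n::nat. op_norm G (T n - S)) \<longlonglongrightarrow> 0 \<longrightarrow> S \<in> J)"

definition averaging_projection ::
    "('g, 'r) monoid_scheme \<Rightarrow> ('g, 'a::unital_cstar_algebra) operator" where
  "averaging_projection G =
     op_scaleC (1 / of_nat (order G)) (\<Sum>g\<in>carrier G. reg_unitary G g)"

definition averaging_ideal ::
    "('g, 'r) monoid_scheme \<Rightarrow> ('g \<Rightarrow> 'a \<Rightarrow> 'a) \<Rightarrow> ('g, 'a::unital_cstar_algebra) operator set" where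
  "averaging_ideal G \<alpha> = \<Inter> {J. closed_ideal G \<alpha> J \<and> averaging_projection G \<in> J}"

definition saturated ::
    "('g, 'r) monoid_scheme \<Rightarrow> ('g \<Rightarrow> 'a \<Rightarrow> 'a::unital_cstar_algebra) \<Rightarrow> bool" where
  "saturated G \<alpha> \<longleftrightarrow> averaging_ideal G \<alpha> = crossed_product G \<alpha>"

end

theory Submission
  imports
    Defs
    "HOL-Computational_Algebra.Formal_Power_Series"
    "HOL-Analysis.Bounded_Linear_Function"
begin

text \<open>
  An element \<open>\<Sum>a e b\<close> of the ideal generated by \<open>e\<close> has coefficients \<open>\<Sum>a \<alpha>\<^sub>g(b) / |G|\<close>.  Both (i)
  and (v) say that such coefficients can approximate the delta function at \<open>\<iota>\<close>, while (ii), (iii)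
  and (iv) are all equivalent to the existence of \<open>u\<^sub>i\<close> with
  \<open>\<Sum>u\<^sub>i \<alpha>\<^sub>g(u\<^sub>i\<^sup>\<star>) = |G| \<delta>\<^sub>g\<^sub>\<iota>\<close>, that is, \<open>\<Sum>u\<^sub>i e u\<^sub>i\<^sup>\<star> = 1\<close>.  To pass from the approximation to
  the exact identity, let the crossed product act on the Hilbert \<open>M\<^sup>\<alpha>\<close>-module \<open>M\<close> with inner product
  \<open>E(x\<^sup>\<star>y)\<close>, where \<open>a e b\<close> becomes \<open>x \<mapsto> a E(bx)\<close>.  A Neumann series corrects the
  approximation to an exact frame \<open>x = \<Sum>a E(bx)\<close> of \<open>M\<close>; the elements \<open>p = a, b\<^sup>\<star>\<close> then have a frame operator
  \<open>T x = \<Sum>p E(p\<^sup>\<star>x)\<close> bounded below, and \<open>u = T\<^sup>-\<^sup>1\<^sup>/\<^sup>2 p\<close> is a quasi-basis of the desired form.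
  The functional calculus involved only needs the binomial series.
\<close>

section \<open>The binomial series in a Banach algebra\<close>

text \<open>The calculus runs on operators on \<open>M\<close> and not in the crossed product,
  because the latter is a set, while the results on series and positivity are about types. The price
  is that the operator norm used here is no C*-norm: it comes from the norm of \<open>M\<close>,
  which agrees with the norm of the inner product \<open>E(x\<^sup>\<star>y)\<close> only up to the
  factor sqrt |G|. Self-adjoint operators are therefore controlled through bounds on all their
  powers. A second frame is needed because the Neumann correction leaves \<open>a\<close> and
  \<open>b\<close> unrelated, while a quasi-basis demands \<open>b = a\<^sup>\<star>\<close>. The
  action of the crossed product on \<open>M\<close> need not be faithful (a trivial action of a
  nontrivial group is an example). Hence a frame of \<open>M\<close> alone proves no identity in the
  crossed product: the approximation is used a second time, or, when starting from (ii), the value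
  of the index.\<close>

lemma gbinomial_Suc_rec: "(a gchoose Suc k) = (a - real k) / real (Suc k) * (a gchoose k)" for a :: real
  using gbinomial_absorb_comp[of a k] gbinomial_absorption[of k a]
  by (simp add: field_simps)

text \<open>Consecutive terms have the ratio \<open>(k - a) / (k + 1)\<close>, which lies between 0
  and 1. These are the Taylor coefficients of \<open>(1 - x)^a\<close>.\<close>

lemma alternating_gbinomial_bounds:
  fixes a :: real
  assumes "-1 \<le> a" "a \<le> 0"
  shows "0 \<le> (-1) ^ k * (a gchoose k) \<and> (-1) ^ k * (a gchoose k) \<le> 1"
proof (induction k)
  case (Suc k)
  have eq: "(-1) ^ Suc k * (a gchoose Suc k) = (real k - a) / real (Suc k) * ((-1) ^ k * (a gchoose k))"
    unfolding gbinomial_Suc_rec by (simp add: field_simps)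
  have "0 \<le> (real k - a) / real (Suc k)" "(real k - a) / real (Suc k) \<le> 1"
    using assms by (simp_all add: field_simps)
  then show ?case
    unfolding eq using Suc by (blast intro: mult_nonneg_nonneg mult_le_one)
qed simp

lemma abs_gbinomial_le_1:
  fixes a :: real
  assumes "-1 \<le> a" "a \<le> 0"
  shows "\<bar>a gchoose k\<bar> \<le> 1"
proof -
  have "\<bar>a gchoose k\<bar> = \<bar>(-1) ^ k * (a gchoose k)\<bar>" by (simp add: abs_mult)
  then show ?thesis using alternating_gbinomial_bounds[OF assms, of k] by simp
qed

text \<open>All coefficients of 1 - sqrt(1 - x) are nonnegative, which makes its partial sums at x =
  1 sums of absolute values.\<close>

lemma half_gbinomial_sign: "(-1) ^ k * ((1/2::real) gchoose Suc k) \<ge> 0"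
proof (induction k)
  case (Suc k)
  have "(-1) ^ Suc k * ((1/2::real) gchoose Suc (Suc k))
      = (real (Suc k) - 1/2) / real (Suc (Suc k)) * ((-1) ^ k * ((1/2::real) gchoose Suc k))"
    unfolding gbinomial_Suc_rec[of _ "Suc k"] by (simp add: field_simps)
  then show ?case using Suc by simp
qed simp

text \<open>The alternating partial sums have the closed form
  \<open>(-1)^m * (-1/2 gchoose m)\<close>, which is nonnegative. The bound 1 is the value of 1 -
  sqrt(1 - x) at x = 1; it makes the square root series converge on the closed unit ball.\<close>

lemma half_gbinomial_sum_le: "(\<Sum>k<m. \<bar>(1/2::real) gchoose Suc k\<bar>) \<le> 1"
proof -
  have "\<bar>(1/2::real) gchoose Suc k\<bar> = (-1) ^ k * ((1/2::real) gchoose Suc k)" for k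
    using half_gbinomial_sign[of k] by (simp add: abs_if minus_one_power_iff split: if_splits)
  then have "(\<Sum>k<m. \<bar>(1/2::real) gchoose Suc k\<bar>) = (\<Sum>k<m. (-1) ^ k * ((1/2::real) gchoose Suc k))"
    by simp
  also have "\<dots> = 1 - (\<Sum>k\<le>m. ((1/2::real) gchoose k) * (-1) ^ k)"
    by (simp add: sum.atMost_shift sum_negf[symmetric] mult.commute)
  also have "\<dots> \<le> 1"
    unfolding gbinomial_sum_lower_neg using alternating_gbinomial_bounds[of "-1/2" m] by simp
  finally show ?thesis .
qed

lemma half_gbinomial_summable: "summable (\<lambda>k. \<bar>(1/2::real) gchoose Suc k\<bar>)"
  by (rule summableI_nonneg_bounded) (auto intro: half_gbinomial_sum_le)

lemma half_gbinomial_suminf_le: "(\<Sum>k. \<bar>(1/2::real) gchoose Suc k\<bar>) \<le> 1"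
  by (rule suminf_le_const[OF half_gbinomial_summable half_gbinomial_sum_le])

text \<open>This is \<open>(1 - x)^a\<close>; the sign suits elements written as
  \<open>1 - x\<close> with \<open>x\<close> small.\<close>

definition binomial_series :: "real \<Rightarrow> 'b \<Rightarrow> 'b::{real_normed_algebra_1, banach}" where
  "binomial_series a x = (\<Sum>k. (a gchoose k) *\<^sub>R (- x) ^ k)"

text \<open>Absolute convergence is a separate predicate because it arises in two ways: from
  \<open>norm x \<le> 1\<close> when \<open>a = 1/2\<close>, and from geometric decay of the powers
  of \<open>x\<close> when \<open>a\<close> lies in [-1, 0].\<close>

definition binomial_summable :: "real \<Rightarrow> 'b::{real_normed_algebra_1, banach} \<Rightarrow> bool" where
  "binomial_summable a x \<longleftrightarrow> summable (\<lambda>k. norm ((a gchoose k) *\<^sub>R (- x) ^ k))"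

lemma binomial_series_sums:
  assumes "binomial_summable a x"
  shows "(\<lambda>k. (a gchoose k) *\<^sub>R (- x) ^ k) sums binomial_series a x"
  using assms unfolding binomial_summable_def binomial_series_def
  by (rule summable_sums[OF summable_norm_cancel])

text \<open>The Cauchy product reduces the law of exponents to the Vandermonde convolution. Square
  roots, inverses and inverse square roots are all instances.\<close>

lemma binomial_series_mult:
  assumes "binomial_summable a x" "binomial_summable b x"
  shows "binomial_series a x * binomial_series b x = binomial_series (a + b) x"
proof -
  have "(\<Sum>i\<le>k. (a gchoose i) *\<^sub>R (- x) ^ i * ((b gchoose (k - i)) *\<^sub>R (- x) ^ (k - i)))
      = ((a + b) gchoose k) *\<^sub>R (- x) ^ k" for k
  proof -
    have "(\<Sum>i\<le>k. (a gchoose i) *\<^sub>R (- x) ^ i * ((b gchoose (k - i)) *\<^sub>R (- x) ^ (k - i)))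
        = (\<Sum>i\<le>k. ((a gchoose i) * (b gchoose (k - i))) *\<^sub>R (- x) ^ k)"
      by (intro sum.cong refl) (simp flip: power_add)
    also have "\<dots> = ((a + b) gchoose k) *\<^sub>R (- x) ^ k"
      unfolding scaleR_sum_left[symmetric] atMost_atLeast0 gbinomial_Vandermonde ..
    finally show ?thesis .
  qed
  then show ?thesis
    unfolding binomial_series_def
    using Cauchy_product[OF assms[unfolded binomial_summable_def]] by simp
qed

lemma binomial_series_1: "binomial_series 1 x = 1 - x"
proof -
  have "(1::real) gchoose k = (if k = 0 then 1 else if k = 1 then 1 else 0)" for k
    using binomial_gbinomial[of 1 k, where 'a = real] by (auto simp: binomial_eq_0)
  then have "binomial_series 1 x = (\<Sum>k\<in>{0,1}. ((1::real) gchoose k) *\<^sub>R (- x) ^ k)"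
    unfolding binomial_series_def by (intro suminf_finite) auto
  then show ?thesis by simp
qed

lemma binomial_series_0: "binomial_series 0 x = 1"
proof -
  have "binomial_series 0 x = (\<Sum>k\<in>{0}. ((0::real) gchoose k) *\<^sub>R (- x) ^ k)"
    unfolding binomial_series_def by (intro suminf_finite) (auto simp: gbinomial_0_left)
  then show ?thesis by simp
qed

lemma binomial_summable_1: "binomial_summable 1 x"
proof -
  have "(1::real) gchoose k = (if k = 0 then 1 else if k = 1 then 1 else 0)" for k
    using binomial_gbinomial[of 1 k, where 'a = real] by (auto simp: binomial_eq_0)
  then show ?thesis
    unfolding binomial_summable_def by (intro summable_finite[of "{0,1}"]) auto
qed

lemma binomial_summable_half:
  assumes "norm x \<le> 1"
  shows "binomial_summable (1/2) x"
proof -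
  have "summable (\<lambda>k. norm (((1/2::real) gchoose Suc k) *\<^sub>R (- x) ^ Suc k))"
  proof (rule summable_comparison_test'[OF half_gbinomial_summable])
    fix k
    have "norm ((- x) ^ Suc k) \<le> 1"
      using norm_power_ineq[of "- x" "Suc k"] power_le_one[of "norm x" "Suc k"] assms by simp
    then show "norm (norm (((1/2::real) gchoose Suc k) *\<^sub>R (- x) ^ Suc k)) \<le> \<bar>(1/2::real) gchoose Suc k\<bar>"
      by (simp add: mult_left_le del: power_Suc)
  qed
  then show ?thesis unfolding binomial_summable_def by (subst (asm) summable_Suc_iff)
qed

text \<open>For self-adjoint \<open>x\<close> this bound says that the square root of
  \<open>1 - x\<close> is itself positive, with \<open>t = 1\<close> in
  \<open>cpositive\<close>.\<close>

lemma binomial_series_half_near_1: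
  assumes "norm x \<le> 1"
  shows "norm (1 - binomial_series (1/2) x) \<le> 1"
proof -
  let ?f = "\<lambda>k. ((1/2::real) gchoose k) *\<^sub>R (- x) ^ k"
  have s: "summable (\<lambda>k. norm (?f k))"
    using binomial_summable_half[OF assms] by (simp add: binomial_summable_def)
  have "binomial_series (1/2) x - 1 = (\<Sum>k. ?f (Suc k))"
    using suminf_split_head[OF summable_norm_cancel[OF s]] by (simp add: binomial_series_def)
  also have "norm \<dots> \<le> (\<Sum>k. norm (?f (Suc k)))"
    using s by (intro summable_norm) (subst summable_Suc_iff)
  also have "\<dots> \<le> (\<Sum>k. \<bar>(1/2::real) gchoose Suc k\<bar>)"
  proof (rule suminf_le)
    fix k
    have "norm ((- x) ^ Suc k) \<le> 1"
      using norm_power_ineq[of "- x" "Suc k"] power_le_one[of "norm x" "Suc k"] assms by simp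
    then show "norm (?f (Suc k)) \<le> \<bar>(1/2::real) gchoose Suc k\<bar>"
      by (simp add: mult_left_le del: power_Suc)
  next
    show "summable (\<lambda>k. norm (?f (Suc k)))" using s by (subst summable_Suc_iff)
  qed (rule half_gbinomial_summable)
  also have "\<dots> \<le> 1" by (rule half_gbinomial_suminf_le)
  finally show ?thesis by (simp add: norm_minus_commute)
qed

text \<open>The hypothesis concerns powers, with a constant \<open>C\<close>, because it is applied
  to operators whose own norm may exceed 1.\<close>

lemma binomial_summable_geometric:
  assumes "-1 \<le> a" "a \<le> 0" "\<bar>r\<bar> < 1" "\<And>k. norm (x ^ k) \<le> C * r ^ k"
  shows "binomial_summable a x"
  unfolding binomial_summable_def
proof (rule summable_comparison_test')
  show "summable (\<lambda>k. C * r ^ k)"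
    using assms(3) by (intro summable_mult summable_geometric) simp
  fix k
  have "norm ((- x) ^ k) = norm (x ^ k)" by (cases "even k") simp_all
  then have "norm ((a gchoose k) *\<^sub>R (- x) ^ k) \<le> 1 * norm (x ^ k)"
    using abs_gbinomial_le_1[OF assms(1,2), of k] by (simp add: mult_left_le_one_le)
  then show "norm (norm ((a gchoose k) *\<^sub>R (- x) ^ k)) \<le> C * r ^ k"
    using assms(4)[of k] by simp
qed

lemma binomial_series_commute:
  assumes "binomial_summable a x" "y * x = x * y"
  shows "y * binomial_series a x = binomial_series a x * y"
proof -
  note s = summable_norm_cancel[OF assms(1)[unfolded binomial_summable_def]]
  have "(- x) ^ k * y = y * (- x) ^ k" for k
    using assms(2) by (intro power_commuting_commutes) simp
  then show ?thesis
    unfolding binomial_series_def suminf_mult[OF s, symmetric] suminf_mult2[OF s] by simp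
qed

section \<open>Positivity in C*-algebras\<close>

lemma scaleC_zero_left [simp]: "0 *\<^sub>C (x::'a::unital_cstar_algebra) = 0"
  using scaleC_of_real[of 0 x] by simp

lemma scaleC_zero_right [simp]: "c *\<^sub>C (0::'a::unital_cstar_algebra) = 0"
  using scaleC_add_right[of c 0 "0::'a"] by simp

lemma scaleC_one [simp]: "1 *\<^sub>C (x::'a::unital_cstar_algebra) = x"
  using scaleC_of_real[of 1 x] by simp

lemma scaleC_minus_right [simp]: "c *\<^sub>C (- (x::'a::unital_cstar_algebra)) = - (c *\<^sub>C x)"
  using scaleC_add_right[of c x "- x"] by (simp add: eq_neg_iff_add_eq_0 add.commute)

lemma scaleC_minus_left [simp]: "(- c) *\<^sub>C (x::'a::unital_cstar_algebra) = - (c *\<^sub>C x)"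
  using scaleC_add_left[of c "- c" x] by (simp add: eq_neg_iff_add_eq_0 add.commute)

lemma scaleC_diff_right: "c *\<^sub>C (x - y) = c *\<^sub>C x - c *\<^sub>C (y::'a::unital_cstar_algebra)"
  using scaleC_add_right[of c x "- y"] by simp

lemma scaleC_sum_right: "c *\<^sub>C (\<Sum>i\<in>A. f i) = (\<Sum>i\<in>A. c *\<^sub>C (f i :: 'a::unital_cstar_algebra))"
  by (induction A rule: infinite_finite_induct) (simp_all add: scaleC_add_right)

lemma star_zero [simp]: "(0::'a::unital_cstar_algebra)\<^sup>\<star> = 0"
  using star_add[of "0::'a" 0] by simp

lemma star_one [simp]: "(1::'a::unital_cstar_algebra)\<^sup>\<star> = 1"
  by (metis mult.right_neutral star_mult star_star)

lemma star_minus [simp]: "(- x)\<^sup>\<star> = - (x::'a::unital_cstar_algebra)\<^sup>\<star>"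
  using star_add[of x "- x"] by (simp add: eq_neg_iff_add_eq_0 add.commute)

lemma star_diff: "(x - y)\<^sup>\<star> = x\<^sup>\<star> - (y::'a::unital_cstar_algebra)\<^sup>\<star>"
  using star_add[of x "- y"] by simp

lemma star_scaleR: "(r *\<^sub>R x)\<^sup>\<star> = r *\<^sub>R (x::'a::unital_cstar_algebra)\<^sup>\<star>"
  using star_scaleC[of "complex_of_real r" x] by (simp add: scaleC_of_real)

lemma star_sum: "(\<Sum>i\<in>A. f i)\<^sup>\<star> = (\<Sum>i\<in>A. (f i :: 'a::unital_cstar_algebra)\<^sup>\<star>)"
  by (induction A rule: infinite_finite_induct) (simp_all add: star_add)

lemma star_sum_list: "(sum_list xs)\<^sup>\<star> = sum_list (map star (xs :: 'a::unital_cstar_algebra list))"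
  by (induction xs) (simp_all add: star_add)

lemma star_power: "(x ^ k)\<^sup>\<star> = (x::'a::unital_cstar_algebra)\<^sup>\<star> ^ k"
  by (induction k) (simp_all add: star_mult power_commutes)

lemma norm_star [simp]: "norm (x\<^sup>\<star>) = norm (x::'a::unital_cstar_algebra)"
proof -
  have le: "norm y \<le> norm (y\<^sup>\<star>)" for y :: 'a
  proof (cases "y = 0")
    case False
    have "norm y * norm y \<le> norm (y\<^sup>\<star>) * norm y"
      using norm_mult_ineq[of "y\<^sup>\<star>" y] by (simp add: cstar_identity power2_eq_square)
    then show ?thesis using False by simp
  qed simp
  show ?thesis using le[of x] le[of "x\<^sup>\<star>"] by (simp add: star_star)
qed

lemma bounded_linear_star: "bounded_linear (star :: 'a::unital_cstar_algebra \<Rightarrow> 'a)"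
  by (rule bounded_linear_intro[of _ 1]) (simp_all add: star_add star_scaleR)

lemma norm_square_selfadjoint: "x\<^sup>\<star> = x \<Longrightarrow> norm (x * x) = (norm x)\<^sup>2" for x :: "'a::unital_cstar_algebra"
  using cstar_identity[of x] by simp

lemma binomial_series_selfadjoint:
  fixes x :: "'a::unital_cstar_algebra"
  assumes "binomial_summable a x" "x\<^sup>\<star> = x"
  shows "(binomial_series a x)\<^sup>\<star> = binomial_series a x"
proof -
  have "(\<lambda>k. ((a gchoose k) *\<^sub>R (- x) ^ k)\<^sup>\<star>) sums (binomial_series a x)\<^sup>\<star>"
    by (rule bounded_linear.sums[OF bounded_linear_star binomial_series_sums[OF assms(1)]])
  then have "(\<lambda>k. (a gchoose k) *\<^sub>R (- x) ^ k) sums (binomial_series a x)\<^sup>\<star>"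
    by (simp add: star_scaleR star_power assms(2))
  then show ?thesis using binomial_series_sums[OF assms(1)] sums_unique2 by blast
qed

text \<open>
  For a self-adjoint element the norm condition says that the spectrum lies in \<open>[0, 2t]\<close>; it makes
  positivity accessible without spectral theory.
\<close>

definition cpositive :: "'a::unital_cstar_algebra \<Rightarrow> bool" where
  "cpositive a \<longleftrightarrow> a\<^sup>\<star> = a \<and> (\<exists>t. norm (t *\<^sub>R 1 - a) \<le> t)"

lemma cpositive_selfadjoint: "cpositive a \<Longrightarrow> a\<^sup>\<star> = a"
  by (simp add: cpositive_def)

text \<open>The bounds \<open>t\<close> simply add. With a spectral definition of positivity this
  would be the hard closure property.\<close>

lemma cpositive_add:
  assumes "cpositive a" "cpositive b"
  shows "cpositive (a + b)"
proof -
  obtain s t where "norm (s *\<^sub>R 1 - a) \<le> s" "norm (t *\<^sub>R 1 - b) \<le> t"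
    using assms by (auto simp: cpositive_def)
  then have "norm ((s + t) *\<^sub>R 1 - (a + b)) \<le> s + t"
    using norm_triangle_ineq[of "s *\<^sub>R 1 - a" "t *\<^sub>R 1 - b"] by (simp add: algebra_simps)
  then show ?thesis using assms by (auto simp: cpositive_def star_add)
qed

lemma cpositive_zero [simp]: "cpositive 0"
  by (auto simp: cpositive_def intro: exI[of _ 0])

lemma cpositive_scaleR:
  assumes "cpositive a" "0 \<le> r"
  shows "cpositive (r *\<^sub>R a)"
proof -
  obtain t where t: "norm (t *\<^sub>R 1 - a) \<le> t" using assms by (auto simp: cpositive_def)
  have "norm ((r * t) *\<^sub>R 1 - r *\<^sub>R a) = r * norm (t *\<^sub>R 1 - a)"
    using assms(2) by (metis abs_of_nonneg norm_scaleR scaleR_right_diff_distrib scaleR_scaleR)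
  also have "\<dots> \<le> r * t" using t assms(2) by (rule mult_left_mono)
  finally show ?thesis using assms by (auto simp: cpositive_def star_scaleR)
qed

lemma cpositive_of_real: "0 \<le> r \<Longrightarrow> cpositive (r *\<^sub>R (1::'a::unital_cstar_algebra))"
  by (auto simp: cpositive_def star_scaleR intro: exI[of _ r])

lemma cpositive_sum: "(\<And>i. i \<in> A \<Longrightarrow> cpositive (f i)) \<Longrightarrow> cpositive (\<Sum>i\<in>A. f i)"
  by (induction A rule: infinite_finite_induct) (auto intro: cpositive_add)

lemma cpositive_sum_list: "(\<And>i. i \<in> set xs \<Longrightarrow> cpositive (f i)) \<Longrightarrow> cpositive (\<Sum>i\<leftarrow>xs. f i)"
  by (induction xs) (auto intro: cpositive_add)

lemma cpositive_norm_diff: "a\<^sup>\<star> = a \<Longrightarrow> norm a \<le> t \<Longrightarrow> cpositive (t *\<^sub>R 1 - a)"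
  by (auto simp: cpositive_def star_diff star_scaleR intro!: exI[of _ t])

text \<open>After scaling, \<open>x = 1 - a/t\<close> has norm at most 1 and the root is sqrt t
  times \<open>(1 - x)^(1/2)\<close>. The last clause holds since the root is a limit of polynomials
  in \<open>a\<close>; it replaces the functional calculus whenever commuting roots are
  needed.\<close>

lemma cpositive_sqrt:
  assumes "cpositive a"
  obtains b where "cpositive b" "b * b = a" "\<And>z. z * a = a * z \<Longrightarrow> z * b = b * z"
proof -
  obtain t where t: "norm (t *\<^sub>R 1 - a) \<le> t" and sa: "a\<^sup>\<star> = a"
    using assms by (auto simp: cpositive_def)
  have t0: "0 \<le> t" using t norm_ge_zero order_trans by blast
  show ?thesis
  proof (cases "t = 0")
    case True
    then have "a = 0" using t by simp
    then show ?thesis using that[of 0] by simp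
  next
    case False
    define x where "x = 1 - (1/t) *\<^sub>R a"
    define y where "y = binomial_series (1/2) x"
    have "t *\<^sub>R x = t *\<^sub>R 1 - a" using False by (simp add: x_def algebra_simps)
    then have "t * norm x \<le> t" using t t0 by (metis abs_of_nonneg norm_scaleR)
    then have x1: "norm x \<le> 1" using False t0 by simp
    note s = binomial_summable_half[OF x1]
    have xs: "x\<^sup>\<star> = x" by (simp add: x_def star_diff star_scaleR sa)
    have yy: "y * y = (1/t) *\<^sub>R a"
      using binomial_series_mult[OF s s] by (simp add: y_def binomial_series_1 x_def)
    have "cpositive y"
      unfolding cpositive_def using binomial_series_half_near_1[OF x1] binomial_series_selfadjoint[OF s xs]
      by (auto simp: y_def intro!: exI[of _ 1])
    then have "cpositive (sqrt t *\<^sub>R y)" using t0 by (intro cpositive_scaleR) simp_all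
    moreover have "(sqrt t *\<^sub>R y) * (sqrt t *\<^sub>R y) = a"
      using yy t0 False by simp
    moreover have "z * (sqrt t *\<^sub>R y) = (sqrt t *\<^sub>R y) * z" if "z * a = a * z" for z
    proof -
      have "z * x = x * z" using that by (simp add: x_def algebra_simps)
      from binomial_series_commute[OF s this] show ?thesis by (simp add: y_def)
    qed
    ultimately show ?thesis using that by blast
  qed
qed

text \<open>Here \<open>b + i c\<close> is \<open>s\<close> times a unitary.\<close>

lemma norm_le_of_sum_squares:
  fixes b c :: "'a::unital_cstar_algebra"
  assumes b: "b\<^sup>\<star> = b" and c: "c\<^sup>\<star> = c" and comm: "b * c = c * b"
    and eq: "b * b + c * c = (s\<^sup>2) *\<^sub>R 1" and "0 \<le> s"
  shows "norm b \<le> s"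
proof -
  define u where "u = b + \<i> *\<^sub>C c"
  have us: "u\<^sup>\<star> = b - \<i> *\<^sub>C c"
    by (simp add: u_def star_add star_scaleC b c)
  have "u\<^sup>\<star> * u = b * b + c * c"
    unfolding us by (simp add: u_def algebra_simps scaleC_mult_left scaleC_mult_right scaleC_scaleC comm scaleC_diff_right scaleC_add_right)
  then have "(norm u)\<^sup>2 = s\<^sup>2" using cstar_identity[of u] eq by simp
  then have nu: "norm u = s" using \<open>0 \<le> s\<close> by simp
  have "2 *\<^sub>R b = u + u\<^sup>\<star>" unfolding us by (simp add: u_def scaleR_2)
  then have "2 * norm b \<le> norm u + norm (u\<^sup>\<star>)"
    by (metis abs_numeral norm_scaleR norm_triangle_ineq)
  then show ?thesis by (simp add: nu)
qed

text \<open>With \<open>t\<close> the squared norm of \<open>b\<close> and \<open>c\<close> the root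
  of \<open>t - b\<^sup>2\<close>, the squares of \<open>b\<close> and \<open>c\<close> add up to
  \<open>t\<close>. Hence \<open>norm c \<le> norm b\<close>, and the norm of
  \<open>t - b\<^sup>2 = c\<^sup>2\<close> is at most \<open>t\<close>.\<close>

lemma cpositive_square:
  fixes b :: "'a::unital_cstar_algebra"
  assumes b: "b\<^sup>\<star> = b"
  shows "cpositive (b * b)"
proof -
  define t where "t = (norm b)\<^sup>2"
  have "cpositive (t *\<^sub>R 1 - b * b)"
    by (rule cpositive_norm_diff) (simp_all add: star_mult b t_def norm_square_selfadjoint)
  then obtain c where c: "cpositive c" "c * c = t *\<^sub>R 1 - b * b"
      and comm: "\<And>z. z * (t *\<^sub>R 1 - b * b) = (t *\<^sub>R 1 - b * b) * z \<Longrightarrow> z * c = c * z"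
    by (rule cpositive_sqrt) blast
  have "c * b = b * c"
    using comm[of b] by (simp add: algebra_simps)
  then have "norm c \<le> norm b"
    using c b by (intro norm_le_of_sum_squares[of c b]) (auto simp: cpositive_selfadjoint t_def)
  then have "norm (c * c) \<le> t"
    unfolding t_def norm_square_selfadjoint[OF cpositive_selfadjoint[OF c(1)]]
    by (rule power_mono) simp
  then show ?thesis
    unfolding cpositive_def c(2) by (auto simp: star_mult b)
qed

text \<open>The roots \<open>r\<close> and \<open>s\<close> of the factors commute as well, so the
  product is the square of the self-adjoint element \<open>r * s\<close>.\<close>

lemma cpositive_commuting_mult:
  assumes a: "cpositive a" and b: "cpositive b" and ab: "a * b = b * a"
  shows "cpositive (a * b)"
proof -
  obtain r where r: "cpositive r" "r * r = a" and rc: "\<And>z. z * a = a * z \<Longrightarrow> z * r = r * z"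
    using cpositive_sqrt[OF a] by blast
  obtain s where s: "cpositive s" "s * s = b" and sc: "\<And>z. z * b = b * z \<Longrightarrow> z * s = s * z"
    using cpositive_sqrt[OF b] by blast
  have "b * r = r * b" using rc ab by simp
  then have rs: "r * s = s * r" using sc[of r] by simp
  have "(r * s) * (r * s) = a * b"
    unfolding r(2)[symmetric] s(2)[symmetric] by (metis mult.assoc rs)
  moreover have "(r * s)\<^sup>\<star> = r * s"
    using r s rs by (simp add: star_mult cpositive_selfadjoint)
  ultimately show ?thesis using cpositive_square by metis
qed

lemma cpositive_of_real_iff: "cpositive (s *\<^sub>R (1::'a::unital_cstar_algebra)) \<longleftrightarrow> 0 \<le> s"
proof
  assume "cpositive (s *\<^sub>R (1::'a))"
  then obtain t where "norm (t *\<^sub>R 1 - s *\<^sub>R (1::'a)) \<le> t" by (auto simp: cpositive_def)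
  then show "0 \<le> s" by (simp add: scaleR_diff_left[symmetric] del: scaleR_diff_left)
qed (rule cpositive_of_real)

text \<open>Shifting to the midpoint, \<open>c = a - s/2\<close> satisfies
  \<open>c\<^sup>2 + a (s - a) = (s/2)\<^sup>2\<close>, and \<open>a (s - a)\<close> is a square
  because it is positive. So the norm of \<open>c\<close> is at most \<open>s/2\<close>.\<close>

lemma cpositive_norm_le:
  fixes a :: "'a::unital_cstar_algebra"
  assumes a: "cpositive a" and sa: "cpositive (s *\<^sub>R 1 - a)"
  shows "norm a \<le> s"
proof -
  have s0: "0 \<le> s" using cpositive_add[OF sa a] cpositive_of_real_iff[where 'a = 'a] by simp
  define c where "c = a - (s/2) *\<^sub>R 1"
  have "cpositive (a * (s *\<^sub>R 1 - a))"
    by (rule cpositive_commuting_mult[OF a sa]) (simp add: algebra_simps)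
  then obtain d where d: "cpositive d" "d * d = a * (s *\<^sub>R 1 - a)"
      and dc: "\<And>z. z * (a * (s *\<^sub>R 1 - a)) = (a * (s *\<^sub>R 1 - a)) * z \<Longrightarrow> z * d = d * z"
    using cpositive_sqrt by blast
  have "c * d = d * c"
    by (rule dc) (simp add: c_def algebra_simps)
  moreover have "c * c + d * d = ((s/2)\<^sup>2) *\<^sub>R 1"
    unfolding d(2) by (simp add: c_def algebra_simps power2_eq_square scaleR_add_left[symmetric])
  moreover have "c\<^sup>\<star> = c" using a by (simp add: c_def star_diff star_scaleR cpositive_selfadjoint)
  ultimately have "norm c \<le> s / 2"
    using d(1) s0 by (intro norm_le_of_sum_squares[of c d]) (auto simp: cpositive_selfadjoint)
  moreover have "norm a \<le> norm c + norm ((s/2) *\<^sub>R (1::'a))"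
    unfolding c_def using norm_triangle_ineq[of "a - (s/2) *\<^sub>R 1" "(s/2) *\<^sub>R 1"] by simp
  ultimately show ?thesis using s0 by simp
qed

lemma cpositive_norm_mono:
  assumes a: "cpositive a" and "cpositive (b - a)"
  shows "norm a \<le> norm b"
proof -
  have "cpositive b" using cpositive_add[OF assms] by simp
  then have "cpositive (norm b *\<^sub>R 1 - b)"
    by (intro cpositive_norm_diff) (auto simp: cpositive_selfadjoint)
  from cpositive_add[OF this assms(2)] show ?thesis
    by (intro cpositive_norm_le[OF a]) simp
qed

text \<open>The \<open>t\<close> in the definition could vary with \<open>e\<close>. The single
  value \<open>norm a + 1\<close> bounds the norms of all \<open>a + e\<close> with
  \<open>e \<le> 1\<close>, and so serves for all of them.\<close>

lemma cpositive_limit: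
  fixes a :: "'a::unital_cstar_algebra"
  assumes "\<And>e. e > 0 \<Longrightarrow> cpositive (a + e *\<^sub>R 1)"
  shows "cpositive a"
proof -
  have "(a + 1 *\<^sub>R 1)\<^sup>\<star> = a + 1 *\<^sub>R 1" using assms[of 1] cpositive_selfadjoint by fastforce
  then have sa: "a\<^sup>\<star> = a" by (simp add: star_add)
  define t where "t = norm a + 1"
  have "norm (t *\<^sub>R 1 - a) \<le> t + e" if "0 < e" "e \<le> 1" for e
  proof -
    have p: "cpositive (a + e *\<^sub>R 1)" using assms that by blast
    have "norm (a + e *\<^sub>R 1) \<le> t"
      using norm_triangle_ineq[of a "e *\<^sub>R 1"] that by (simp add: t_def)
    then have "cpositive (t *\<^sub>R 1 - (a + e *\<^sub>R 1))"
      using p by (intro cpositive_norm_diff) (auto simp: cpositive_selfadjoint)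
    then have "norm (t *\<^sub>R 1 - (a + e *\<^sub>R 1)) \<le> t"
      by (rule cpositive_norm_le) (use p in \<open>simp add: add.commute\<close>)
    moreover have "norm (t *\<^sub>R 1 - a) \<le> norm (t *\<^sub>R 1 - (a + e *\<^sub>R 1)) + norm (e *\<^sub>R (1::'a))"
      using norm_triangle_ineq[of "t *\<^sub>R 1 - (a + e *\<^sub>R 1)" "e *\<^sub>R 1"] by simp
    ultimately show ?thesis using that by simp
  qed
  then have "norm (t *\<^sub>R 1 - a) \<le> t + e" if "0 < e" for e
    using that by (cases "e \<le> 1") (auto intro: order_trans[of _ "t + 1"])
  then have "norm (t *\<^sub>R 1 - a) \<le> t" by (rule field_le_epsilon)
  then show ?thesis using sa by (auto simp: cpositive_def)
qed

text \<open>Dividing by \<open>t\<close> puts the spectrum of \<open>q/t\<close> into [e/t, 1], so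
  \<open>x = 1 - q/t\<close> has norm below 1 and the series for \<open>(1 - x)^(-1/2)\<close>
  converges geometrically.\<close>

lemma cpositive_inverse_sqrt:
  fixes q :: "'a::unital_cstar_algebra"
  assumes q: "cpositive (q - e *\<^sub>R 1)" and e: "e > 0"
  obtains w where "w\<^sup>\<star> = w" "w * w * q = 1" "\<And>z. z * q = q * z \<Longrightarrow> z * w = w * z"
proof -
  have qp: "cpositive q" using cpositive_add[OF q cpositive_of_real[of e]] e by simp
  define t where "t = norm q + e"
  have t0: "t > 0" using e by (simp add: t_def add_nonneg_pos)
  define x where "x = 1 - (1/t) *\<^sub>R q"
  have tx: "t *\<^sub>R x = t *\<^sub>R 1 - q" using t0 by (simp add: x_def algebra_simps)
  have "cpositive (t *\<^sub>R 1 - q)"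
    using qp e by (intro cpositive_norm_diff) (auto simp: cpositive_selfadjoint t_def)
  then have "norm (t *\<^sub>R 1 - q) \<le> t - e"
    by (rule cpositive_norm_le) (use q in \<open>simp add: algebra_simps\<close>)
  then have "t * norm x \<le> t - e" using tx t0 by (metis abs_of_pos norm_scaleR)
  then have "norm x \<le> 1 - e / t" using t0 by (simp add: field_simps)
  moreover have "e / t > 0" using e t0 by simp
  ultimately have nx: "norm x < 1" by linarith
  have s: "binomial_summable a x" if "-1 \<le> a" "a \<le> 0" for a
    by (rule binomial_summable_geometric[of a "norm x" x 1]) (use that nx norm_power_ineq[of x] in auto)
  define y where "y = binomial_series (-1/2) x"
  have xs: "x\<^sup>\<star> = x" using qp by (simp add: x_def star_diff star_scaleR cpositive_selfadjoint)
  have "y * y * binomial_series 1 x = 1"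
    using binomial_series_mult[OF s[of "-1/2"] s[of "-1/2"]]
      binomial_series_mult[OF s[of "-1"] binomial_summable_1, simplified]
    by (simp add: y_def binomial_series_0)
  then have "t *\<^sub>R ((1/t) *\<^sub>R (y * y * q)) = t *\<^sub>R 1" by (simp add: binomial_series_1 x_def)
  then have yy: "y * y * q = t *\<^sub>R 1" using t0 by simp
  have ys: "y\<^sup>\<star> = y" unfolding y_def by (rule binomial_series_selfadjoint[OF s xs]) simp_all
  have yc: "z * y = y * z" if "z * q = q * z" for z
    unfolding y_def using that
    by (intro binomial_series_commute[OF s]) (simp_all add: x_def algebra_simps)
  show ?thesis
  proof (rule that[of "(1 / sqrt t) *\<^sub>R y"])
    show "(1 / sqrt t) *\<^sub>R y * ((1 / sqrt t) *\<^sub>R y) * q = 1" using yy t0 by simp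
  qed (simp_all add: star_scaleR ys yc)
qed

text \<open>Here \<open>p\<close> is the absolute value of \<open>a\<close>; the point is
  \<open>a \<le> p\<close>. The element \<open>q = p + e\<close> is invertible and
  \<open>q\<^sup>2 - a\<^sup>2 = 2 e p + e\<^sup>2\<close> is positive, so \<open>c = a/q\<close>
  has norm at most 1. Then \<open>(1 - c) q = p - a + e\<close> is positive, and \<open>e\<close>
  tends to 0.\<close>

lemma cpositive_abs:
  fixes a :: "'a::unital_cstar_algebra"
  assumes a: "a\<^sup>\<star> = a"
  obtains p where "cpositive p" "p * p = a * a" "p * a = a * p" "cpositive (p - a)"
proof -
  obtain p where p: "cpositive p" "p * p = a * a" and pc: "\<And>z. z * (a * a) = (a * a) * z \<Longrightarrow> z * p = p * z"
    using cpositive_sqrt[OF cpositive_square[OF a]] by blast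
  have pa: "p * a = a * p" using pc[of a] by (simp add: mult.assoc)
  have "cpositive (p - a + e *\<^sub>R 1)" if e: "e > 0" for e
  proof -
    define q where "q = p + e *\<^sub>R 1"
    have qp: "cpositive q" unfolding q_def using p e by (intro cpositive_add cpositive_of_real) auto
    obtain w where w: "w\<^sup>\<star> = w" "w * w * q = 1" and wc: "\<And>z. z * q = q * z \<Longrightarrow> z * w = w * z"
    proof (rule cpositive_inverse_sqrt[OF _ e])
      show "cpositive (q - e *\<^sub>R 1)" using p by (simp add: q_def)
    qed blast
    have wa: "a * w = w * a" by (rule wc) (simp add: q_def algebra_simps pa)
    have wp: "p * w = w * p" by (rule wc) (simp add: q_def algebra_simps)
    have wq: "q * w = w * q" by (rule wc) simp
    define c where "c = w * w * a"
    have cs: "c\<^sup>\<star> = c"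
      unfolding c_def using w(1) a by (simp add: star_mult) (metis mult.assoc wa)
    have aq: "a * q = q * a" by (simp add: q_def algebra_simps pa)
    have "c * q = (w * w * q) * a" by (simp add: c_def mult.assoc aq)
    then have cq: "c * q = a" by (simp add: w(2))
    have "q * c = w * w * q * a" unfolding c_def by (metis mult.assoc wq)
    then have cqc: "c * q = q * c" by (simp add: cq w(2))
    have m: "cpositive ((2 * e) *\<^sub>R p + (e\<^sup>2) *\<^sub>R 1)"
      using p e by (intro cpositive_add cpositive_scaleR cpositive_of_real) auto
    have vv: "(w * w) * (w * w) * (q * q) = 1"
      by (metis mult.assoc mult.right_neutral w(2) wq)
    have "q * q = a * a + ((2 * e) *\<^sub>R p + (e\<^sup>2) *\<^sub>R 1)"
      unfolding p(2)[symmetric] by (simp add: q_def algebra_simps power2_eq_square mult_2 flip: scaleR_2)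
    moreover have "c * c = (w * w) * (w * w) * (a * a)"
    proof -
      have "c * c = (w * w) * (a * (w * w)) * a" by (simp add: c_def mult.assoc)
      also have "a * (w * w) = (w * w) * a" by (metis mult.assoc wa)
      finally show ?thesis by (simp add: mult.assoc)
    qed
    ultimately have "1 - c * c = (w * w) * (w * w) * ((2 * e) *\<^sub>R p + (e\<^sup>2) *\<^sub>R 1)"
      using vv by (simp only: distrib_left[of _ "a * a"] eq_diff_eq diff_eq_eq add.commute)
    moreover have "cpositive ((w * w) * (w * w) * ((2 * e) *\<^sub>R p + (e\<^sup>2) *\<^sub>R 1))"
    proof (rule cpositive_commuting_mult[OF _ m])
      show "cpositive ((w * w) * (w * w))" by (rule cpositive_square) (simp add: star_mult w(1))
      have "(w * w) * (w * w) * p = p * ((w * w) * (w * w))" by (metis mult.assoc wp)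
      then show "(w * w) * (w * w) * ((2 * e) *\<^sub>R p + (e\<^sup>2) *\<^sub>R 1)
        = ((2 * e) *\<^sub>R p + (e\<^sup>2) *\<^sub>R 1) * ((w * w) * (w * w))"
        by (simp add: distrib_left distrib_right)
    qed
    ultimately have "cpositive (1 *\<^sub>R 1 - c * c)" by simp
    then have "norm (c * c) \<le> 1" by (rule cpositive_norm_le[OF cpositive_square[OF cs]])
    then have "norm c \<le> 1" by (simp add: norm_square_selfadjoint[OF cs] power_le_one_iff abs_square_le_1)
    then have "cpositive (1 *\<^sub>R 1 - c)" by (rule cpositive_norm_diff[OF cs])
    then have "cpositive ((1 *\<^sub>R 1 - c) * q)"
      by (rule cpositive_commuting_mult[OF _ qp]) (simp add: algebra_simps cqc)
    then show ?thesis by (simp add: algebra_simps cq) (simp add: q_def algebra_simps)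
  qed
  then have "cpositive (p - a)" by (rule cpositive_limit)
  then show ?thesis using that p pa by blast
qed

text \<open>The inverse \<open>z\<close> is the square of \<open>z * r\<close>, hence positive and
  at most \<open>norm z\<close>. Multiplying \<open>norm z - z\<close> by \<open>q\<close> gives the
  gap \<open>e = 1 / norm z\<close>.\<close>

lemma cpositive_inverse_bound:
  assumes q: "cpositive q" and z: "z * q = 1" "q * z = 1"
  obtains e where "e > 0" "cpositive (q - e *\<^sub>R 1)"
proof -
  obtain r where r: "cpositive r" "r * r = q" and rc: "\<And>y. y * q = q * y \<Longrightarrow> y * r = r * y"
    using cpositive_sqrt[OF q] by blast
  have zr: "z * r = r * z" by (rule rc) (simp add: z)
  have zs: "z\<^sup>\<star> = z"
    by (metis (no_types, lifting) cpositive_selfadjoint[OF q] mult.assoc mult.left_neutral mult.right_neutral star_mult star_one z)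
  have "cpositive ((z * r) * (z * r))"
    by (rule cpositive_square) (simp add: star_mult zs cpositive_selfadjoint[OF r(1)] zr)
  moreover have "(z * r) * (z * r) = z"
    by (metis mult.assoc mult.right_neutral r(2) z(2) zr)
  ultimately have "cpositive z" by simp
  have "z \<noteq> 0" using z by auto
  have "cpositive (norm z *\<^sub>R 1 - z)" by (rule cpositive_norm_diff[OF zs]) simp
  from cpositive_commuting_mult[OF this q]
  have "cpositive (norm z *\<^sub>R q - 1)" by (simp add: algebra_simps z)
  from cpositive_scaleR[OF this, of "1 / norm z"]
  have "cpositive (q - (1 / norm z) *\<^sub>R 1)" using \<open>z \<noteq> 0\<close> by (simp add: algebra_simps)
  then show ?thesis using that[of "1 / norm z"] \<open>z \<noteq> 0\<close> by simp
qed

text \<open>Up to the factor 2 and a sign, \<open>h\<close> and \<open>k\<close> are the real and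
  imaginary parts of \<open>y\<close>.\<close>

lemma star_mult_self_add:
  fixes y :: "'a::unital_cstar_algebra"
  shows "cpositive (y\<^sup>\<star> * y + y * y\<^sup>\<star>)"
proof -
  define h where "h = y + y\<^sup>\<star>"
  define k where "k = \<i> *\<^sub>C (y - y\<^sup>\<star>)"
  have "h\<^sup>\<star> = h" "k\<^sup>\<star> = k"
    by (simp_all add: h_def k_def star_add star_diff star_scaleC star_star scaleC_diff_right)
  then have "cpositive ((1/2) *\<^sub>R (h * h + k * k))"
    by (intro cpositive_scaleR cpositive_add cpositive_square) simp_all
  moreover have "h * h + k * k = 2 *\<^sub>R (y\<^sup>\<star> * y + y * y\<^sup>\<star>)"
    by (simp add: h_def k_def scaleC_mult_left scaleC_mult_right scaleC_scaleC scaleC_diff_right algebra_simps scaleR_2)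
  ultimately show ?thesis by simp
qed

text \<open>If \<open>-y\<^sup>\<star>y\<close> is positive, then so is \<open>yy\<^sup>\<star>\<close>; but \<open>N - yy\<^sup>\<star>\<close> is invertible for all \<open>N > 0\<close>,
  its inverse being expressible through that of \<open>N - y\<^sup>\<star>y\<close>, so \<open>yy\<^sup>\<star>\<close> cannot have norm \<open>N\<close>.\<close>

lemma negative_star_mult_self:
  fixes y :: "'a::unital_cstar_algebra"
  assumes neg: "cpositive (- (y\<^sup>\<star> * y))"
  shows "y = 0"
proof -
  define P where "P = y * y\<^sup>\<star>"
  have P: "cpositive P"
    using cpositive_add[OF star_mult_self_add[of y] neg] by (simp add: P_def)
  define N where "N = norm P"
  have "N = 0"
  proof (rule ccontr)
    assume "N \<noteq> 0"
    then have N: "N > 0" by (simp add: N_def)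
    define a where "a = N *\<^sub>R 1 - y\<^sup>\<star> * y"
    obtain w where w: "w * w * a = 1" and wc: "\<And>z. z * a = a * z \<Longrightarrow> z * w = w * z"
    proof (rule cpositive_inverse_sqrt[OF _ N])
      show "cpositive (a - N *\<^sub>R 1)" using neg by (simp add: a_def)
    qed blast
    define v where "v = w * w"
    have va: "v * a = 1" and av: "a * v = 1"
      using w wc[of a] by (simp_all add: v_def) (metis mult.assoc)
    \<comment> \<open>The resolvent formula: the inverse of \<open>N - y y\<^sup>\<star>\<close> is
      \<open>(1 + y v y\<^sup>\<star>) / N\<close>, with \<open>v\<close> the inverse of
      \<open>N - y\<^sup>\<star> y\<close>.\<close>
    define z where "z = (1/N) *\<^sub>R (1 + y * v * y\<^sup>\<star>)"
    define q where "q = N *\<^sub>R 1 - P"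
    have "N *\<^sub>R v - y\<^sup>\<star> * y * v = 1" using av by (simp add: a_def algebra_simps)
    then have "y * (N *\<^sub>R v - y\<^sup>\<star> * y * v) * y\<^sup>\<star> = P" by (simp add: P_def)
    then have "q * (1 + y * v * y\<^sup>\<star>) = N *\<^sub>R 1"
      by (simp add: q_def P_def algebra_simps)
    then have qz: "q * z = 1" using N by (simp add: z_def)
    have "N *\<^sub>R v - v * (y\<^sup>\<star> * y) = 1" using va by (simp add: a_def algebra_simps)
    then have "y * (N *\<^sub>R v - v * (y\<^sup>\<star> * y)) * y\<^sup>\<star> = P" by (simp add: P_def)
    then have "(1 + y * v * y\<^sup>\<star>) * q = N *\<^sub>R 1"
      by (simp add: q_def P_def algebra_simps)
    then have zq: "z * q = 1" using N by (simp add: z_def)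
    have "cpositive q" unfolding q_def
      by (rule cpositive_norm_diff) (auto simp: cpositive_selfadjoint[OF P] N_def)
    then obtain e where "e > 0" "cpositive (q - e *\<^sub>R 1)"
      using cpositive_inverse_bound zq qz by blast
    then have "cpositive ((N - e) *\<^sub>R 1 - P)" by (simp add: q_def algebra_simps)
    from cpositive_norm_le[OF P this] \<open>e > 0\<close> show False by (simp add: N_def)
  qed
  then have "(norm (y\<^sup>\<star>))\<^sup>2 = 0" using cstar_identity[of "y\<^sup>\<star>"] by (simp add: N_def P_def star_star)
  then show ?thesis by simp
qed

text \<open>The element \<open>n\<close> is twice the negative part of
  \<open>a = x\<^sup>\<star> x\<close>, and \<open>n a n = - n\<^sup>3 / 2\<close>. So the square
  \<open>(x n)\<^sup>\<star> (x n)\<close> is negative, which forces \<open>x n = 0\<close>, hence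
  \<open>n = 0\<close>, and \<open>a\<close> equals its absolute value.\<close>

theorem cpositive_star_mult_self:
  fixes x :: "'a::unital_cstar_algebra"
  shows "cpositive (x\<^sup>\<star> * x)"
proof -
  define a where "a = x\<^sup>\<star> * x"
  have a: "a\<^sup>\<star> = a" by (simp add: a_def star_mult star_star)
  obtain p where p: "cpositive p" "p * p = a * a" "p * a = a * p" "cpositive (p - a)"
    using cpositive_abs[OF a] by blast
  define n where "n = p - a"
  have n: "cpositive n" using p by (simp add: n_def)
  have ns: "n\<^sup>\<star> = n" using n by (rule cpositive_selfadjoint)
  have nn: "n * n = - (2 *\<^sub>R (a * n))" using p by (simp add: n_def algebra_simps scaleR_2)
  have an: "a * n = n * a" using p by (simp add: n_def algebra_simps)
  have "n * n * n = - (2 *\<^sub>R (n * a * n))" unfolding nn by (simp add: an)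
  then have nan: "- (n * a * n) = (1/2) *\<^sub>R (n * n * n)" by simp
  have nnn: "cpositive (n * n * n)"
    by (rule cpositive_commuting_mult[OF cpositive_square[OF ns] n]) (simp add: mult.assoc)
  have eq: "(x * n)\<^sup>\<star> * (x * n) = n * a * n" by (simp add: star_mult ns a_def mult.assoc)
  have "cpositive (- ((x * n)\<^sup>\<star> * (x * n)))"
    unfolding eq nan by (rule cpositive_scaleR[OF nnn]) simp
  then have "x * n = 0" by (rule negative_star_mult_self)
  then have "n * a * n = 0" using eq by simp
  then have "n * n * n = 0" using nan by simp
  then have "norm ((n * n) * (n * n)) = 0" by (simp add: mult.assoc[symmetric])
  then have "n = 0" by (simp add: norm_square_selfadjoint star_mult ns)
  then show ?thesis using p by (simp add: n_def a_def)
qed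

lemma positive_element_iff: "positive_element a \<longleftrightarrow> cpositive a"
proof
  assume "cpositive a"
  then obtain b where "cpositive b" "b * b = a" using cpositive_sqrt by blast
  then have "a = b\<^sup>\<star> * b" by (simp add: cpositive_selfadjoint)
  then show "positive_element a" by (auto simp: positive_element_def)
qed (auto simp: positive_element_def cpositive_star_mult_self)

lemma cpositive_conjugate:
  assumes "cpositive a"
  shows "cpositive (x\<^sup>\<star> * a * x)"
proof -
  obtain b where b: "cpositive b" "b * b = a" using cpositive_sqrt[OF assms] by blast
  have "x\<^sup>\<star> * a * x = (b * x)\<^sup>\<star> * (b * x)"
    by (simp add: star_mult cpositive_selfadjoint[OF b(1)] b(2)[symmetric] mult.assoc)
  then show ?thesis by (simp add: cpositive_star_mult_self)
qed

lemma cpositive_sum_norm_le: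
  assumes "finite A" "\<And>i. i \<in> A \<Longrightarrow> cpositive (f i)" "i \<in> A"
  shows "norm (f i) \<le> norm (\<Sum>i\<in>A. f i)"
proof -
  have "cpositive ((\<Sum>i\<in>A. f i) - f i)"
    using assms by (simp add: sum.remove[of A i]) (rule cpositive_sum, simp)
  then show ?thesis using assms by (intro cpositive_norm_mono) auto
qed

section \<open>The Banach algebra of bounded operators\<close>

text \<open>A copy of \<open>'a \<Rightarrow>\<^sub>L 'a\<close>: the type of bounded linear maps between two different spaces
  cannot carry composition as its multiplication.\<close>

typedef (overloaded) 'a endo = "UNIV :: ('a::real_normed_vector \<Rightarrow>\<^sub>L 'a) set"
  morphisms blinfun_of_endo Endo by simp

setup_lifting type_definition_endo

instantiation endo :: (real_normed_vector) real_normed_vector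
begin

lift_definition zero_endo :: "'a endo" is 0 .
lift_definition plus_endo :: "'a endo \<Rightarrow> 'a endo \<Rightarrow> 'a endo" is "(+)" .
lift_definition minus_endo :: "'a endo \<Rightarrow> 'a endo \<Rightarrow> 'a endo" is "(-)" .
lift_definition uminus_endo :: "'a endo \<Rightarrow> 'a endo" is uminus .
lift_definition scaleR_endo :: "real \<Rightarrow> 'a endo \<Rightarrow> 'a endo" is scaleR .
lift_definition norm_endo :: "'a endo \<Rightarrow> real" is norm .
lift_definition dist_endo :: "'a endo \<Rightarrow> 'a endo \<Rightarrow> real" is dist .
lift_definition sgn_endo :: "'a endo \<Rightarrow> 'a endo" is sgn .

definition uniformity_endo :: "('a endo \<times> 'a endo) filter" where
  "uniformity_endo = (INF e\<in>{0<..}. principal {(x, y). dist x y < e})"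

definition open_endo :: "'a endo set \<Rightarrow> bool" where
  "open_endo U \<longleftrightarrow> (\<forall>x\<in>U. \<forall>\<^sub>F (x', y) in uniformity. x' = x \<longrightarrow> y \<in> U)"

instance
  by standard
    (simp_all add: blinfun_of_endo_inject[symmetric] zero_endo.rep_eq plus_endo.rep_eq minus_endo.rep_eq
      uminus_endo.rep_eq scaleR_endo.rep_eq norm_endo.rep_eq dist_endo.rep_eq sgn_endo.rep_eq
      uniformity_endo_def open_endo_def dist_norm sgn_div_norm norm_triangle_ineq
      scaleR_add_left scaleR_add_right)

end

text \<open>The sort \<open>perfect_space\<close> excludes the zero space, on which the identity
  would have norm 0.\<close>

instantiation endo :: ("{real_normed_vector, perfect_space}") real_normed_algebra_1
begin

lift_definition one_endo :: "'a endo" is id_blinfun .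
lift_definition times_endo :: "'a endo \<Rightarrow> 'a endo \<Rightarrow> 'a endo" is blinfun_compose .

instance
proof
  show "norm (1 :: 'a endo) = 1" by transfer (rule norm_blinfun_id)
  then show "(0 :: 'a endo) \<noteq> 1" by (metis norm_zero zero_neq_one)
qed (transfer, (rule norm_blinfun_compose | simp add: blinfun_eqI blinfun.bilinear_simps))+

end

instance endo :: (banach) banach
proof
  fix X :: "nat \<Rightarrow> 'a endo"
  assume "Cauchy X"
  then have "Cauchy (\<lambda>n. blinfun_of_endo (X n))"
    by (simp add: Cauchy_def dist_endo.rep_eq)
  then obtain l where "(\<lambda>n. blinfun_of_endo (X n)) \<longlonglongrightarrow> l"
    using Cauchy_convergent convergent_def by blast
  then have "X \<longlonglongrightarrow> Endo l"
    by (simp add: lim_sequentially dist_endo.rep_eq Endo_inverse)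
  then show "convergent X" by (auto simp: convergent_def)
qed

lift_definition endo_apply :: "'a::real_normed_vector endo \<Rightarrow> 'a \<Rightarrow> 'a" is blinfun_apply .

definition endo_of :: "('a::real_normed_vector \<Rightarrow> 'a) \<Rightarrow> 'a endo" where
  "endo_of f = Endo (Blinfun f)"

lemma endo_apply_endo_of: "bounded_linear f \<Longrightarrow> endo_apply (endo_of f) = f"
  by (simp add: endo_of_def endo_apply.rep_eq Endo_inverse bounded_linear_Blinfun_apply)

lemma endo_apply_simps [simp]:
  "endo_apply 0 x = 0"
  "endo_apply (S + T) x = endo_apply S x + endo_apply T x"
  "endo_apply (S - T) x = endo_apply S x - endo_apply T x"
  "endo_apply (- S) x = - endo_apply S x"
  "endo_apply (r *\<^sub>R S) x = r *\<^sub>R endo_apply S x"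
  by (transfer, simp add: blinfun.bilinear_simps)+

lemma endo_apply_one [simp]: "endo_apply 1 x = x"
  by transfer simp

lemma endo_apply_mult [simp]: "endo_apply (S * T) x = endo_apply S (endo_apply T x)"
  by transfer simp

lemma bounded_linear_endo_apply: "bounded_linear (endo_apply T)"
  by transfer (rule blinfun.bounded_linear_right)

lemma norm_endo_apply: "norm (endo_apply T x) \<le> norm T * norm x"
  by transfer (rule norm_blinfun)

lemma bounded_linear_endo_eval: "bounded_linear (\<lambda>T. endo_apply T x)"
  by (rule bounded_linear_intro[of _ "norm x"])
    (simp_all add: norm_endo_apply)

lemma norm_endo_le: "0 \<le> b \<Longrightarrow> (\<And>x. norm (endo_apply T x) \<le> b * norm x) \<Longrightarrow> norm T \<le> b"
  by transfer (rule norm_blinfun_bound)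

section \<open>Actions of finite groups\<close>

lemma sum_list_sum_swap:
  "(\<Sum>p\<leftarrow>L. \<Sum>g\<in>A. f p g) = (\<Sum>g\<in>A. \<Sum>p\<leftarrow>L. (f p g :: 'b::comm_monoid_add))"
  by (induction L) (simp_all add: sum.distrib)

lemma sum_nth_eq_sum_list: "(\<Sum>i=1..length us. f (us ! (i - 1))) = (\<Sum>u\<leftarrow>us. f u :: 'b::comm_monoid_add)"
proof -
  have "(\<Sum>i=1..length us. f (us ! (i - 1))) = (\<Sum>i<length us. f (us ! i))"
    by (rule sum.reindex_bij_witness[of _ Suc "\<lambda>i. i - 1"]) auto
  then show ?thesis by (simp add: sum_list_sum_nth atLeast0LessThan)
qed

locale finite_cstar_action = group G for G :: "('g, 'r) monoid_scheme" (structure) +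
  fixes \<alpha> :: "'g \<Rightarrow> 'a \<Rightarrow> 'a::unital_cstar_algebra"
  assumes finite_carrier: "finite (carrier G)" and action: "cstar_action G \<alpha>"
begin

abbreviation E where "E \<equiv> canonical_expectation G \<alpha>"
abbreviation n where "n \<equiv> real (order G)"
abbreviation fixed where "fixed \<equiv> fixed_point_algebra G \<alpha>"

lemma is_group_action: "group_action G UNIV \<alpha>"
  using action by (simp add: cstar_action_def)

lemma \<alpha>_comp: "g \<in> carrier G \<Longrightarrow> h \<in> carrier G \<Longrightarrow> \<alpha> g (\<alpha> h x) = \<alpha> (g \<otimes> h) x"
  using group_action.composition_rule[OF is_group_action, of x g h] by simp

lemma \<alpha>_one_group [simp]: "\<alpha> \<one> x = x"
  using group_action.id_eq_one[OF is_group_action] by (metis UNIV_I restrict_apply)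

lemma \<alpha>_hom: "g \<in> carrier G \<Longrightarrow> star_homomorphism (\<alpha> g)"
  using action by (simp add: cstar_action_def)

lemma
  assumes g: "g \<in> carrier G"
  shows \<alpha>_add: "\<alpha> g (x + y) = \<alpha> g x + \<alpha> g y"
    and \<alpha>_scaleC: "\<alpha> g (c *\<^sub>C x) = c *\<^sub>C \<alpha> g x"
    and \<alpha>_mult: "\<alpha> g (x * y) = \<alpha> g x * \<alpha> g y"
    and \<alpha>_star: "\<alpha> g (x\<^sup>\<star>) = (\<alpha> g x)\<^sup>\<star>"
  using \<alpha>_hom[OF g] unfolding star_homomorphism_def Vector_Spaces.linear_iff by simp_all

lemma \<alpha>_scaleR: "g \<in> carrier G \<Longrightarrow> \<alpha> g (r *\<^sub>R x) = r *\<^sub>R \<alpha> g x"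
  using \<alpha>_scaleC[of g "complex_of_real r" x] by (simp add: scaleC_of_real)

lemma \<alpha>_zero [simp]: "g \<in> carrier G \<Longrightarrow> \<alpha> g 0 = 0"
  using \<alpha>_scaleR[of g 0 0] by simp

lemma \<alpha>_minus: "g \<in> carrier G \<Longrightarrow> \<alpha> g (- x) = - \<alpha> g x"
  using \<alpha>_scaleR[of g "-1" x] by simp

lemma \<alpha>_diff: "g \<in> carrier G \<Longrightarrow> \<alpha> g (x - y) = \<alpha> g x - \<alpha> g y"
  using \<alpha>_add[of g x "- y"] by (simp add: \<alpha>_minus)

lemma \<alpha>_sum: "g \<in> carrier G \<Longrightarrow> \<alpha> g (\<Sum>i\<in>A. f i) = (\<Sum>i\<in>A. \<alpha> g (f i))"
  by (induction A rule: infinite_finite_induct) (simp_all add: \<alpha>_add)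

lemma \<alpha>_sum_list: "g \<in> carrier G \<Longrightarrow> \<alpha> g (\<Sum>i\<leftarrow>L. f i) = (\<Sum>i\<leftarrow>L. \<alpha> g (f i))"
  by (induction L) (simp_all add: \<alpha>_add)

lemma \<alpha>_inverse [simp]:
  assumes "g \<in> carrier G"
  shows "\<alpha> g (\<alpha> (inv g) x) = x" "\<alpha> (inv g) (\<alpha> g x) = x"
  using assms by (simp_all add: \<alpha>_comp)

lemma \<alpha>_unit [simp]: "g \<in> carrier G \<Longrightarrow> \<alpha> g 1 = 1"
  using \<alpha>_mult[of g "\<alpha> (inv g) 1" 1] by simp

lemma \<alpha>_cpositive:
  assumes "g \<in> carrier G" "cpositive a"
  shows "cpositive (\<alpha> g a)"
proof -
  obtain b where "cpositive b" "b * b = a" using cpositive_sqrt[OF assms(2)] by blast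
  then have "\<alpha> g a = (\<alpha> g b)\<^sup>\<star> * \<alpha> g b"
    using assms(1) by (metis \<alpha>_mult \<alpha>_star cpositive_selfadjoint)
  then show ?thesis by (simp add: cpositive_star_mult_self)
qed

text \<open>Each automorphism preserves positivity, hence the relation
  \<open>y\<^sup>\<star> y \<le> (norm y)\<^sup>2\<close>, so it is contractive; its inverse is
  contractive too.\<close>

lemma norm_\<alpha> [simp]:
  assumes "g \<in> carrier G"
  shows "norm (\<alpha> g x) = norm x"
proof -
  have le: "norm (\<alpha> h y) \<le> norm y" if h: "h \<in> carrier G" for h y
  proof -
    have "cpositive (((norm y)\<^sup>2) *\<^sub>R 1 - y\<^sup>\<star> * y)"
      by (rule cpositive_norm_diff) (simp_all add: star_mult star_star cstar_identity)
    from \<alpha>_cpositive[OF h this] have "cpositive (((norm y)\<^sup>2) *\<^sub>R 1 - (\<alpha> h y)\<^sup>\<star> * \<alpha> h y)"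
      using h by (simp add: \<alpha>_diff \<alpha>_scaleR \<alpha>_mult \<alpha>_star)
    from cpositive_norm_le[OF cpositive_star_mult_self this] show ?thesis
      by (simp add: cstar_identity)
  qed
  show ?thesis using le[OF assms, of x] le[OF inv_closed[OF assms], of "\<alpha> g x"] assms by simp
qed

lemma order_pos [simp]: "order G > 0"
  using order_gt_0_iff_finite finite_carrier by simp

lemma order_nonzero [simp]: "order G \<noteq> 0"
  using order_pos by simp

lemma n_pos: "n > 0"
  by simp

lemma card_carrier: "real (card (carrier G)) = n"
  by (simp add: order_def)

lemma sum_translate:
  assumes "h \<in> carrier G"
  shows "(\<Sum>g\<in>carrier G. f (h \<otimes> g)) = (\<Sum>g\<in>carrier G. f g)"
  by (rule sum.reindex_bij_witness[of _ "\<lambda>g. inv h \<otimes> g" "\<lambda>g. h \<otimes> g"])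
    (use assms in \<open>simp_all add: m_assoc[symmetric]\<close>)

lemma sum_carrier_delta:
  assumes "h \<in> carrier G"
  shows "(\<Sum>g\<in>carrier G. (if g = h then c else 0) * f g) = c * (f h :: 'a)"
proof -
  have "(\<Sum>g\<in>carrier G. (if g = h then c else 0) * f g) = (\<Sum>g\<in>carrier G. if g = h then c * f h else 0)"
    by (intro sum.cong) auto
  then show ?thesis using assms finite_carrier by (simp add: sum.delta)
qed

lemma nE: "n *\<^sub>R E x = (\<Sum>g\<in>carrier G. \<alpha> g x)"
  using n_pos by (simp add: canonical_expectation_def)

lemma E_add: "E (x + y) = E x + E y"
  by (simp add: canonical_expectation_def \<alpha>_add sum.distrib scaleR_add_right)

lemma E_scaleC: "E (c *\<^sub>C x) = c *\<^sub>C E x"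
  by (simp add: canonical_expectation_def \<alpha>_scaleC scaleC_sum_right[symmetric]
      scaleC_of_real[symmetric] scaleC_scaleC mult.commute)

lemma E_scaleR: "E (r *\<^sub>R x) = r *\<^sub>R E x"
  using E_scaleC[of "complex_of_real r" x] by (simp add: scaleC_of_real)

lemma E_zero [simp]: "E 0 = 0"
  using E_scaleR[of 0 0] by simp

lemma E_diff: "E (x - y) = E x - E y"
  using E_add[of "x - y" y] by simp

lemma E_sum_list: "E (\<Sum>p\<leftarrow>L. f p) = (\<Sum>p\<leftarrow>L. E (f p))"
  by (induction L) (simp_all add: E_add)

lemma E_star: "E (x\<^sup>\<star>) = (E x)\<^sup>\<star>"
  by (simp add: canonical_expectation_def star_scaleR star_sum \<alpha>_star)

lemma E_in_fixed [simp]: "E x \<in> fixed"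
  by (auto simp: fixed_point_algebra_def canonical_expectation_def \<alpha>_scaleR \<alpha>_sum \<alpha>_comp sum_translate[of _ "\<lambda>g. \<alpha> g x"])

lemma fixedD: "c \<in> fixed \<Longrightarrow> g \<in> carrier G \<Longrightarrow> \<alpha> g c = c"
  by (simp add: fixed_point_algebra_def)

lemma E_fixed:
  assumes "c \<in> fixed"
  shows "E c = c"
proof -
  have "(\<Sum>g\<in>carrier G. \<alpha> g c) = (\<Sum>g\<in>carrier G. c)"
    using assms by (intro sum.cong) (simp_all add: fixedD)
  also have "\<dots> = n *\<^sub>R c" by (simp only: sum_constant_scaleR card_carrier)
  finally show ?thesis by (simp add: canonical_expectation_def)
qed

lemma E_mult_left: "c \<in> fixed \<Longrightarrow> E (c * x) = c * E x"
  by (simp add: canonical_expectation_def \<alpha>_mult fixedD sum_distrib_left)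

lemma E_mult_right: "c \<in> fixed \<Longrightarrow> E (x * c) = E x * c"
  by (simp add: canonical_expectation_def \<alpha>_mult fixedD sum_distrib_right)

lemma star_fixed: "c \<in> fixed \<Longrightarrow> c\<^sup>\<star> \<in> fixed"
  by (simp add: fixed_point_algebra_def \<alpha>_star)

lemma E_cpositive: "cpositive a \<Longrightarrow> cpositive (E a)"
  unfolding canonical_expectation_def
  by (intro cpositive_scaleR cpositive_sum \<alpha>_cpositive) auto

text \<open>A Pimsner-Popa inequality: the sum \<open>n E(a)\<close> contains \<open>a\<close>
  itself as the term at the identity, and the other terms are positive.\<close>

lemma nE_dominates:
  assumes "cpositive a"
  shows "cpositive (n *\<^sub>R E a - a)"
proof -
  have "n *\<^sub>R E a - a = (\<Sum>g\<in>carrier G - {\<one>}. \<alpha> g a)"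
    unfolding nE using finite_carrier by (simp add: sum.remove[of _ \<one>])
  also have "cpositive \<dots>" using assms by (intro cpositive_sum \<alpha>_cpositive) auto
  finally show ?thesis .
qed

lemma norm_E_le: "norm (E x) \<le> norm x"
proof -
  have "norm (\<Sum>g\<in>carrier G. \<alpha> g x) \<le> (\<Sum>g\<in>carrier G. norm (\<alpha> g x))" by (rule norm_sum)
  then show ?thesis by (simp add: canonical_expectation_def card_carrier field_simps)
qed

text \<open>Compares the norm of \<open>M\<close> with that of the inner product
  \<open>E(x\<^sup>\<star>y)\<close>. It also gives the faithfulness of \<open>E\<close>.\<close>

lemma norm_square_le_E: "(norm x)\<^sup>2 \<le> n * norm (E (x\<^sup>\<star> * x))"
  using cpositive_norm_mono[OF cpositive_star_mult_self nE_dominates[OF cpositive_star_mult_self[of x]]]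
  by (simp add: cstar_identity)

lemma bounded_linear_E: "bounded_linear E"
  by (rule bounded_linear_intro[of _ 1]) (simp_all add: E_add E_scaleR norm_E_le)

text \<open>The Kadison-Schwarz inequality: the difference is \<open>E\<close> applied to the square
  of \<open>x - E x\<close>.\<close>

lemma E_star_mult_E_le: "cpositive (E (x\<^sup>\<star> * x) - (E x)\<^sup>\<star> * E x)"
proof -
  have "cpositive (E ((x - E x)\<^sup>\<star> * (x - E x)))"
    by (intro E_cpositive cpositive_star_mult_self)
  then show ?thesis
    by (simp add: star_diff algebra_simps E_add E_diff E_mult_left E_mult_right star_fixed E_fixed E_star)
qed

text \<open>The coefficients of the element \<open>\<Sum>(a,b)\<leftarrow>L. |G| a e b\<close> of the crossed product.\<close>

definition coef :: "('a \<times> 'a) list \<Rightarrow> 'g \<Rightarrow> 'a" where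
  "coef L g = (\<Sum>p\<leftarrow>L. fst p * \<alpha> g (snd p))"

text \<open>The crossed product acts on \<open>M\<close> by sending the coefficient
  \<open>x_g\<close> at \<open>g\<close> to left multiplication by \<open>x_g\<close> after
  \<open>\<alpha> g\<close>. This evaluates that action on the element with coefficients
  \<open>coef L\<close>.\<close>

lemma sum_coef_\<alpha>: "(\<Sum>g\<in>carrier G. coef L g * \<alpha> g x) = n *\<^sub>R (\<Sum>p\<leftarrow>L. fst p * E (snd p * x))"
proof -
  have "(\<Sum>g\<in>carrier G. coef L g * \<alpha> g x)
      = (\<Sum>p\<leftarrow>L. \<Sum>g\<in>carrier G. fst p * \<alpha> g (snd p * x))"
    by (simp add: coef_def sum_list_sum_swap sum_list_mult_const[symmetric] \<alpha>_mult mult.assoc)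
  also have "\<dots> = (\<Sum>p\<leftarrow>L. n *\<^sub>R (fst p * E (snd p * x)))"
    by (simp add: sum_distrib_left[symmetric] nE[symmetric])
  also have "\<dots> = n *\<^sub>R (\<Sum>p\<leftarrow>L. fst p * E (snd p * x))"
    by (induction L) (simp_all add: scaleR_add_right)
  finally show ?thesis .
qed

section \<open>Operators on the Hilbert module \<open>M\<close> over the fixed-point algebra\<close>

lemma bounded_linear_frame: "bounded_linear (\<lambda>x. \<Sum>p\<leftarrow>L. f p * E (h p * x))"
proof (induction L)
  case (Cons p L)
  have "bounded_linear (\<lambda>x. f p * E (h p * x))"
    by (intro bounded_linear_compose[OF bounded_linear_mult_right]
        bounded_linear_compose[OF bounded_linear_E] bounded_linear_mult_right)
  then show ?case using Cons by (simp add: bounded_linear_add)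
qed simp

text \<open>Linearity over the fixed-point algebra gives \<open>T(a E(b x)) = T(a) E(b x)\<close>,
  so that applying an operator to a frame only changes the first entries.\<close>

definition right_linear :: "'a endo \<Rightarrow> bool" where
  "right_linear T \<longleftrightarrow> (\<forall>x. \<forall>c\<in>fixed. endo_apply T (x * c) = endo_apply T x * c)"

definition E_selfadjoint :: "'a endo \<Rightarrow> bool" where
  "E_selfadjoint T \<longleftrightarrow> (\<forall>x y. E ((endo_apply T x)\<^sup>\<star> * y) = E (x\<^sup>\<star> * endo_apply T y))"

lemma right_linear_power: "right_linear T \<Longrightarrow> right_linear (T ^ k)"
  by (induction k) (simp_all add: right_linear_def)

lemma E_selfadjoint_power:
  assumes "E_selfadjoint T"
  shows "E_selfadjoint (T ^ k)"
proof (induction k)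
  case (Suc k)
  have "endo_apply (T ^ k) (endo_apply T y) = endo_apply T (endo_apply (T ^ k) y)" for y
    using arg_cong[OF power_commutes[of T k], of "\<lambda>S. endo_apply S y"] by simp
  then show ?case using assms Suc by (simp add: E_selfadjoint_def)
qed (simp add: E_selfadjoint_def)

lemma binomial_series_apply_sums:
  assumes "binomial_summable a T"
  shows "(\<lambda>k. (a gchoose k) *\<^sub>R endo_apply ((- T) ^ k) x) sums endo_apply (binomial_series a T) x"
  using bounded_linear.sums[OF bounded_linear_endo_eval binomial_series_sums[OF assms], of x] by simp

lemma right_linear_binomial_series:
  assumes "binomial_summable a T" "right_linear T"
  shows "right_linear (binomial_series a T)"
  unfolding right_linear_def
proof (intro allI ballI)
  fix x c assume c: "c \<in> fixed"
  have "right_linear (- T)" using assms(2) by (simp add: right_linear_def)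
  then have "right_linear ((- T) ^ k)" for k by (rule right_linear_power)
  then have "(\<lambda>k. ((a gchoose k) *\<^sub>R endo_apply ((- T) ^ k) x) * c) sums endo_apply (binomial_series a T) (x * c)"
    using binomial_series_apply_sums[OF assms(1), of "x * c"] c by (simp add: right_linear_def)
  moreover have "(\<lambda>k. ((a gchoose k) *\<^sub>R endo_apply ((- T) ^ k) x) * c) sums (endo_apply (binomial_series a T) x * c)"
    by (rule sums_mult2[OF binomial_series_apply_sums[OF assms(1)]])
  ultimately show "endo_apply (binomial_series a T) (x * c) = endo_apply (binomial_series a T) x * c"
    by (rule sums_unique2)
qed

lemma E_selfadjoint_binomial_series:
  assumes "binomial_summable a T" "E_selfadjoint T"
  shows "E_selfadjoint (binomial_series a T)"
  unfolding E_selfadjoint_def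
proof (intro allI)
  fix x y
  let ?P = "\<lambda>k. (- T) ^ k" and ?B = "binomial_series a T"
  have "E_selfadjoint (- T)" using assms(2)
    by (simp add: E_selfadjoint_def) (metis E_scaleR scaleR_minus1_left)
  then have "E_selfadjoint (?P k)" for k by (rule E_selfadjoint_power)
  then have eq: "E ((endo_apply (?P k) x)\<^sup>\<star> * y) = E (x\<^sup>\<star> * endo_apply (?P k) y)" for k
    by (simp add: E_selfadjoint_def)
  have "bounded_linear (\<lambda>z. E (z\<^sup>\<star> * y))"
    by (intro bounded_linear_compose[OF bounded_linear_E]
        bounded_linear_compose[OF bounded_linear_mult_left] bounded_linear_star)
  from bounded_linear.sums[OF this binomial_series_apply_sums[OF assms(1), of x]]
  have 1: "(\<lambda>k. (a gchoose k) *\<^sub>R E (x\<^sup>\<star> * endo_apply (?P k) y)) sums E ((endo_apply ?B x)\<^sup>\<star> * y)"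
    by (simp add: star_scaleR E_scaleR eq)
  have "bounded_linear (\<lambda>z. E (x\<^sup>\<star> * z))"
    by (intro bounded_linear_compose[OF bounded_linear_E] bounded_linear_mult_right)
  from bounded_linear.sums[OF this binomial_series_apply_sums[OF assms(1), of y]]
  have 2: "(\<lambda>k. (a gchoose k) *\<^sub>R E (x\<^sup>\<star> * endo_apply (?P k) y)) sums E (x\<^sup>\<star> * endo_apply ?B y)"
    by (simp add: E_scaleR)
  show "E ((endo_apply ?B x)\<^sup>\<star> * y) = E (x\<^sup>\<star> * endo_apply ?B y)"
    using sums_unique2[OF 1 2] .
qed

text \<open>A form bound \<open>0 \<le> S \<le> r\<close> gives \<open>S\<^sup>2 \<le> r S \<le> r\<^sup>2\<close>, because
  \<open>r S (r - S) = S (r - S) S + (r - S) S (r - S)\<close>.\<close>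

lemma E_form_contraction:
  assumes sa: "E_selfadjoint S" and r: "r > 0"
    and lower: "\<And>x. cpositive (E (x\<^sup>\<star> * endo_apply S x))"
    and upper: "\<And>x. cpositive (r *\<^sub>R E (x\<^sup>\<star> * x) - E (x\<^sup>\<star> * endo_apply S x))"
  shows "cpositive (r\<^sup>2 *\<^sub>R E (x\<^sup>\<star> * x) - E ((endo_apply S x)\<^sup>\<star> * endo_apply S x))"
proof -
  define y where "y = endo_apply S x"
  have S: "E ((endo_apply S u)\<^sup>\<star> * v) = E (u\<^sup>\<star> * endo_apply S v)" for u v
    using sa by (simp add: E_selfadjoint_def)
  note lin = bounded_linear_endo_apply[of S]
  \<comment> \<open>With \<open>y = S x\<close>, \<open>?A\<close> and \<open>?B\<close> are the
    forms at \<open>x\<close> of S (r - S) S and (r - S) S (r - S).\<close>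
  let ?A = "r *\<^sub>R E (y\<^sup>\<star> * y) - E (y\<^sup>\<star> * endo_apply S y)"
  let ?B = "E ((r *\<^sub>R x - y)\<^sup>\<star> * endo_apply S (r *\<^sub>R x - y))"
  have "endo_apply S (r *\<^sub>R x - y) = r *\<^sub>R y - endo_apply S y"
    unfolding y_def linear_diff[OF bounded_linear.linear[OF lin]] linear_scale[OF bounded_linear.linear[OF lin]] ..
  moreover have "E (y\<^sup>\<star> * y) = E (x\<^sup>\<star> * endo_apply S y)" using S[of x y] by (simp add: y_def)
  ultimately have "?A + ?B = r *\<^sub>R (r *\<^sub>R E (x\<^sup>\<star> * y) - E (y\<^sup>\<star> * y))"
    by (simp add: star_diff star_scaleR left_diff_distrib right_diff_distrib E_diff E_scaleR
        scaleR_diff_right)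
  then have "cpositive ((1/r) *\<^sub>R (r *\<^sub>R (r *\<^sub>R E (x\<^sup>\<star> * y) - E (y\<^sup>\<star> * y))))"
    using cpositive_add[OF upper[of y] lower[of "r *\<^sub>R x - y"]] r by (intro cpositive_scaleR[of _ "1/r"]) simp_all
  then have 1: "cpositive (r *\<^sub>R E (x\<^sup>\<star> * y) - E (y\<^sup>\<star> * y))" using r by simp
  have "cpositive (r *\<^sub>R (r *\<^sub>R E (x\<^sup>\<star> * x) - E (x\<^sup>\<star> * y)))"
    using upper[of x] r by (intro cpositive_scaleR) (simp_all add: y_def)
  from cpositive_add[OF 1 this] show ?thesis
    by (simp add: y_def scaleR_diff_right power2_eq_square)
qed

text \<open>The contraction estimate iterates without loss in the module norm. The factor
  \<open>sqrt n\<close> enters once, on returning to the norm of \<open>M\<close>, so the decay rate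
  \<open>r\<close> survives.\<close>

lemma E_form_power_bound:
  assumes "E_selfadjoint S" and r: "r > 0"
    and "\<And>x. cpositive (E (x\<^sup>\<star> * endo_apply S x))"
    and "\<And>x. cpositive (r *\<^sub>R E (x\<^sup>\<star> * x) - E (x\<^sup>\<star> * endo_apply S x))"
  shows "norm (S ^ k) \<le> sqrt n * r ^ k"
proof (rule norm_endo_le)
  fix x
  let ?y = "endo_apply (S ^ k) x"
  have "cpositive ((r ^ k)\<^sup>2 *\<^sub>R E (x\<^sup>\<star> * x) - E (?y\<^sup>\<star> * ?y))"
  proof (induction k)
    case (Suc k)
    let ?y = "endo_apply (S ^ k) x"
    have "cpositive (r\<^sup>2 *\<^sub>R ((r ^ k)\<^sup>2 *\<^sub>R E (x\<^sup>\<star> * x) - E (?y\<^sup>\<star> * ?y)))"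
      by (rule cpositive_scaleR[OF Suc]) simp
    from cpositive_add[OF this E_form_contraction[OF assms, of ?y]] show ?case
      by (simp add: scaleR_diff_right power_mult_distrib)
  qed simp
  then have "norm (E (?y\<^sup>\<star> * ?y)) \<le> norm ((r ^ k)\<^sup>2 *\<^sub>R E (x\<^sup>\<star> * x))"
    by (intro cpositive_norm_mono E_cpositive cpositive_star_mult_self)
  also have "\<dots> \<le> (r ^ k)\<^sup>2 * (norm x)\<^sup>2"
    using norm_E_le[of "x\<^sup>\<star> * x"] by (simp add: mult_left_mono cstar_identity)
  finally have "(norm ?y)\<^sup>2 \<le> n * ((r ^ k)\<^sup>2 * (norm x)\<^sup>2)"
    using norm_square_le_E[of ?y] n_pos by (meson mult_left_mono of_nat_0_le_iff order_trans)
  also have "\<dots> = (sqrt n * r ^ k * norm x)\<^sup>2"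
    by (simp add: power_mult_distrib)
  finally show "norm ?y \<le> sqrt n * r ^ k * norm x"
    by (rule power2_le_imp_le) (use r in simp)
qed (use r in simp)

text \<open>The coefficients of the unit of the crossed product. The same function, read as a
  vector, later recovers the coefficients of an operator.\<close>

definition delta :: "'g \<Rightarrow> 'a" where
  "delta g = (if g = \<one> then 1 else 0)"

lemma sum_delta_\<alpha>: "(\<Sum>g\<in>carrier G. delta g * \<alpha> g x) = x"
  unfolding delta_def sum_carrier_delta[OF one_closed] by simp

text \<open>In the crossed product this multiplies the element with coefficients \<open>Q\<close> by
  \<open>b\<close> from the right.\<close>

lemma sum_mult_\<alpha>_delta:
  assumes k: "k \<in> carrier G"
  shows "(\<Sum>g\<in>carrier G. Q g * \<alpha> g (b * delta (inv g \<otimes> k))) = Q k * \<alpha> k b"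
proof -
  have "inv g \<otimes> k = \<one> \<longleftrightarrow> g = k" if "g \<in> carrier G" for g
    using k that by (metis inv_closed inv_equality inv_inv l_inv)
  then have "(\<Sum>g\<in>carrier G. Q g * \<alpha> g (b * delta (inv g \<otimes> k)))
      = (\<Sum>g\<in>carrier G. if g = k then Q k * \<alpha> k b else 0)"
    by (intro sum.cong) (auto simp: delta_def)
  then show ?thesis using k finite_carrier by simp
qed

text \<open>The Neumann series inverts the operator \<open>x \<mapsto> \<Sum>(a,b)\<leftarrow>L. |G| a E(b x)\<close>.\<close>

lemma exact_frame:
  assumes approx: "\<And>\<epsilon>. \<epsilon> > 0 \<Longrightarrow> \<exists>L. \<forall>g\<in>carrier G. norm (delta g - coef L g) < \<epsilon>"
  obtains L where "\<And>x. x = (\<Sum>p\<leftarrow>L. fst p * E (snd p * x))"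
proof -
  \<comment> \<open>Adding the errors of all \<open>n\<close> coefficients gives the bound 1/2 for
    the norm of \<open>T\<close>.\<close>
  obtain L where L: "\<forall>g\<in>carrier G. norm (delta g - coef L g) < 1 / (2 * n)"
    using approx[of "1 / (2 * n)"] n_pos by auto
  define f where "f x = n *\<^sub>R (\<Sum>p\<leftarrow>L. fst p * E (snd p * x))" for x
  have blf: "bounded_linear f"
    unfolding f_def by (intro bounded_linear_compose[OF bounded_linear_scaleR_right] bounded_linear_frame)
  define T where "T = 1 - endo_of f"
  have T: "endo_apply T x = x - f x" for x by (simp add: T_def endo_apply_endo_of[OF blf])
  have nT: "norm T \<le> 1/2"
  proof (rule norm_endo_le)
    fix x
    have "x - f x = (\<Sum>g\<in>carrier G. (delta g - coef L g) * \<alpha> g x)"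
      by (simp add: left_diff_distrib sum_subtractf sum_delta_\<alpha> sum_coef_\<alpha> f_def)
    also have "norm \<dots> \<le> (\<Sum>g\<in>carrier G. (1 / (2 * n)) * norm x)"
    proof (rule sum_norm_le)
      fix g assume g: "g \<in> carrier G"
      have "norm ((delta g - coef L g) * \<alpha> g x) \<le> norm (delta g - coef L g) * norm (\<alpha> g x)"
        by (rule norm_mult_ineq)
      also have "\<dots> \<le> (1 / (2 * n)) * norm x"
        using L g by (intro mult_mono) (auto intro: less_imp_le)
      finally show "norm ((delta g - coef L g) * \<alpha> g x) \<le> (1 / (2 * n)) * norm x" .
    qed
    also have "\<dots> = 1/2 * norm x" using n_pos by (simp add: card_carrier)
    finally show "norm (endo_apply T x) \<le> 1/2 * norm x" by (simp add: T)
  qed simp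
  \<comment> \<open>Exponent -1 is the Neumann series: \<open>F\<close> is the inverse of
    \<open>1 - T\<close>, and \<open>1 - T\<close> acts as \<open>f\<close>.\<close>
  have s: "binomial_summable (-1) T"
  proof (rule binomial_summable_geometric[of _ "1/2" _ 1])
    fix k
    have "norm (T ^ k) \<le> norm T ^ k" by (rule norm_power_ineq)
    also have "\<dots> \<le> (1/2) ^ k" using nT by (intro power_mono) simp_all
    finally show "norm (T ^ k) \<le> 1 * (1/2) ^ k" by simp
  qed simp_all
  define F where "F = binomial_series (-1) T"
  have "f (x * c) = f x * c" if "c \<in> fixed" for x c
  proof -
    have "E (snd p * (x * c)) = E (snd p * x) * c" for p :: "'a \<times> 'a"
      using E_mult_right[OF that, of "snd p * x"] by (simp add: mult.assoc)
    then show ?thesis by (simp add: f_def sum_list_mult_const[symmetric] mult.assoc)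
  qed
  then have "right_linear T" by (simp add: right_linear_def T left_diff_distrib)
  then have F: "endo_apply F (x * c) = endo_apply F x * c" if "c \<in> fixed" for x c
    using right_linear_binomial_series[OF s] that by (simp add: right_linear_def F_def)
  have "F * (1 - T) = 1"
    using binomial_series_mult[OF s binomial_summable_1] by (simp add: F_def binomial_series_1 binomial_series_0)
  then have "endo_apply (F * (1 - T)) x = x" for x by simp
  then have "endo_apply F (f x) = x" for x by (simp add: T)
  moreover have "endo_apply F (f x) = (\<Sum>p\<leftarrow>L. endo_apply F (n *\<^sub>R fst p) * E (snd p * x))" for x
  proof -
    have lin: "linear (endo_apply F)" using bounded_linear_endo_apply by (rule bounded_linear.linear)
    have sum: "endo_apply F (\<Sum>p\<leftarrow>L. h p) = (\<Sum>p\<leftarrow>L. endo_apply F (h p))" for h :: "'a \<times> 'a \<Rightarrow> 'a"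
      by (induction L) (simp_all add: linear_add[OF lin] linear_0[OF lin])
    have "n *\<^sub>R (\<Sum>p\<leftarrow>L. fst p * E (snd p * x)) = (\<Sum>p\<leftarrow>L. n *\<^sub>R fst p * E (snd p * x))"
      by (induction L) (simp_all add: scaleR_add_right)
    then show ?thesis by (simp only: f_def sum F[OF E_in_fixed])
  qed
  ultimately show ?thesis
    using that[of "map (\<lambda>p. (endo_apply F (n *\<^sub>R fst p), snd p)) L"] by (simp add: comp_def)
qed

text \<open>For \<open>s = E(a\<^sup>\<star>x)\<close> and \<open>t = E(bx)\<close> the cross terms of a frame are estimated by
  \<open>s\<^sup>\<star>t + t\<^sup>\<star>s \<le> s\<^sup>\<star>s + t\<^sup>\<star>t\<close>.\<close>

lemma lower_frame_bound:
  assumes frame: "\<And>x. x = (\<Sum>p\<leftarrow>L. fst p * E (snd p * x))"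
  obtains ps where "\<And>x. cpositive ((\<Sum>p\<leftarrow>ps. (E (p\<^sup>\<star> * x))\<^sup>\<star> * E (p\<^sup>\<star> * x)) - E (x\<^sup>\<star> * x))"
proof (rule that)
  fix x
  let ?s = "\<lambda>p. E ((fst p)\<^sup>\<star> * x)" and ?t = "\<lambda>p. E (snd p * x)"
  let ?ps = "map fst L @ map (\<lambda>p. (snd p)\<^sup>\<star>) L"
  have "E (x\<^sup>\<star> * x) = E (x\<^sup>\<star> * (\<Sum>p\<leftarrow>L. fst p * ?t p))" by (simp only: frame[symmetric])
  also have "\<dots> = (\<Sum>p\<leftarrow>L. E ((x\<^sup>\<star> * fst p) * ?t p))"
    by (simp add: sum_list_const_mult[symmetric] E_sum_list mult.assoc)
  also have "\<dots> = (\<Sum>p\<leftarrow>L. (?s p)\<^sup>\<star> * ?t p)"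
    by (simp add: E_mult_right E_star[symmetric] star_mult star_star)
  finally have 1: "E (x\<^sup>\<star> * x) = (\<Sum>p\<leftarrow>L. (?s p)\<^sup>\<star> * ?t p)" .
  \<comment> \<open>\<open>E (x\<^sup>\<star> * x)\<close> is self-adjoint, so taking adjoints
    supplies the cross terms in the other order.\<close>
  then have "(E (x\<^sup>\<star> * x))\<^sup>\<star> = (\<Sum>p\<leftarrow>L. (?t p)\<^sup>\<star> * ?s p)"
    by (simp add: star_sum_list star_mult star_star comp_def)
  then have 2: "E (x\<^sup>\<star> * x) = (\<Sum>p\<leftarrow>L. (?t p)\<^sup>\<star> * ?s p)"
    by (simp add: E_star[symmetric] star_mult star_star)
  have pos: "cpositive (\<Sum>p\<leftarrow>L. (?s p - ?t p)\<^sup>\<star> * (?s p - ?t p))"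
    by (intro cpositive_sum_list cpositive_star_mult_self)
  have "(\<Sum>p\<leftarrow>L. (?s p - ?t p)\<^sup>\<star> * (?s p - ?t p)) + (\<Sum>p\<leftarrow>L. (?s p)\<^sup>\<star> * ?t p) + (\<Sum>p\<leftarrow>L. (?t p)\<^sup>\<star> * ?s p)
      = (\<Sum>p\<leftarrow>?ps. (E (p\<^sup>\<star> * x))\<^sup>\<star> * E (p\<^sup>\<star> * x))"
  proof -
    have square: "(s - t)\<^sup>\<star> * (s - t) + s\<^sup>\<star> * t + t\<^sup>\<star> * s = s\<^sup>\<star> * s + t\<^sup>\<star> * t" for s t :: 'a
      by (simp add: star_diff algebra_simps)
    have "(\<Sum>p\<leftarrow>L. (?s p - ?t p)\<^sup>\<star> * (?s p - ?t p)) + (\<Sum>p\<leftarrow>L. (?s p)\<^sup>\<star> * ?t p) + (\<Sum>p\<leftarrow>L. (?t p)\<^sup>\<star> * ?s p)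
      = (\<Sum>p\<leftarrow>L. (?s p)\<^sup>\<star> * ?s p + (?t p)\<^sup>\<star> * ?t p)"
      by (simp only: sum_list_addf[symmetric] square)
    then show ?thesis by (simp add: sum_list_addf comp_def star_star)
  qed
  then have "(\<Sum>p\<leftarrow>L. (?s p - ?t p)\<^sup>\<star> * (?s p - ?t p))
      = (\<Sum>p\<leftarrow>?ps. (E (p\<^sup>\<star> * x))\<^sup>\<star> * E (p\<^sup>\<star> * x)) - E (x\<^sup>\<star> * x) - E (x\<^sup>\<star> * x)"
    by (simp only: 1[symmetric] 2[symmetric] eq_diff_eq)
  with pos have "cpositive ((\<Sum>p\<leftarrow>?ps. (E (p\<^sup>\<star> * x))\<^sup>\<star> * E (p\<^sup>\<star> * x)) - E (x\<^sup>\<star> * x) - E (x\<^sup>\<star> * x))"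
    by (simp only:)
  \<comment> \<open>The cross terms cost \<open>E (x\<^sup>\<star> * x)\<close> twice; one copy is
    given back.\<close>
  from cpositive_add[OF this E_cpositive[OF cpositive_star_mult_self[of x]]]
  show "cpositive ((\<Sum>p\<leftarrow>?ps. (E (p\<^sup>\<star> * x))\<^sup>\<star> * E (p\<^sup>\<star> * x)) - E (x\<^sup>\<star> * x))" by simp
qed

text \<open>In the order of forms the frame operator \<open>T\<close> lies between 1 and
  \<open>c\<close>, so \<open>S = 1 - T/c\<close> lies between 0 and \<open>r < 1\<close>. Then
  \<open>U = (1 - S)^(-1/2)\<close> inverts the square root of \<open>T/c\<close>, and the vectors
  \<open>U p / sqrt c\<close> have frame operator \<open>U (T/c) U = 1\<close>.\<close>

lemma tight_frame:
  assumes lower: "\<And>x. cpositive ((\<Sum>p\<leftarrow>ps. (E (p\<^sup>\<star> * x))\<^sup>\<star> * E (p\<^sup>\<star> * x)) - E (x\<^sup>\<star> * x))"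
  obtains us where "\<And>x. x = (\<Sum>u\<leftarrow>us. u * E (u\<^sup>\<star> * x))"
proof -
  define T where "T x = (\<Sum>p\<leftarrow>ps. p * E (p\<^sup>\<star> * x))" for x
  have blT: "bounded_linear T" unfolding T_def by (rule bounded_linear_frame)
  have ET: "E (y\<^sup>\<star> * T x) = (\<Sum>p\<leftarrow>ps. (E (p\<^sup>\<star> * y))\<^sup>\<star> * E (p\<^sup>\<star> * x))" for x y
  proof -
    have "E (y\<^sup>\<star> * T x) = (\<Sum>p\<leftarrow>ps. E ((y\<^sup>\<star> * p) * E (p\<^sup>\<star> * x)))"
      by (simp add: T_def sum_list_const_mult[symmetric] E_sum_list mult.assoc)
    then show ?thesis by (simp add: E_mult_right E_star[symmetric] star_mult star_star)
  qed
  have ET': "E ((T y)\<^sup>\<star> * x) = E (y\<^sup>\<star> * T x)" for x y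
  proof -
    have "E ((T y)\<^sup>\<star> * x) = (E (x\<^sup>\<star> * T y))\<^sup>\<star>" by (simp add: E_star[symmetric] star_mult star_star)
    also have "\<dots> = E (y\<^sup>\<star> * T x)" by (simp add: ET star_sum_list star_mult star_star comp_def)
    finally show ?thesis .
  qed
  \<comment> \<open>The summand 2 keeps \<open>r = 1 - 1/c\<close> strictly positive, as the power
    bound requires.\<close>
  define c where "c = 2 + (\<Sum>p\<leftarrow>ps. (norm p)\<^sup>2)"
  define r where "r = 1 - 1 / c"
  have c: "c \<ge> 2" unfolding c_def by (auto intro!: sum_list_nonneg)
  then have r: "0 < r" "r < 1" by (simp_all add: r_def)
  define S where "S = 1 - (1 / c) *\<^sub>R endo_of T"
  have S: "endo_apply S x = x - (1 / c) *\<^sub>R T x" for x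
    by (simp add: S_def endo_apply_endo_of[OF blT])
  have ES: "E (y\<^sup>\<star> * endo_apply S x) = E (y\<^sup>\<star> * x) - (1 / c) *\<^sub>R E (y\<^sup>\<star> * T x)" for x y
    by (simp add: S right_diff_distrib E_diff E_scaleR)
  have sa: "E_selfadjoint S"
    unfolding E_selfadjoint_def by (simp add: ES) (simp add: S star_diff star_scaleR left_diff_distrib E_diff E_scaleR ET')
  have single: "cpositive ((norm p)\<^sup>2 *\<^sub>R E (x\<^sup>\<star> * x) - (E (p\<^sup>\<star> * x))\<^sup>\<star> * E (p\<^sup>\<star> * x))" for p x
  proof -
    have "cpositive ((norm p)\<^sup>2 *\<^sub>R 1 - p * p\<^sup>\<star>)"
      using cstar_identity[of "p\<^sup>\<star>"] by (intro cpositive_norm_diff) (simp_all add: star_mult star_star)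
    from E_cpositive[OF cpositive_conjugate[OF this, of x]]
    have "cpositive ((norm p)\<^sup>2 *\<^sub>R E (x\<^sup>\<star> * x) - E ((p\<^sup>\<star> * x)\<^sup>\<star> * (p\<^sup>\<star> * x)))"
      by (simp add: right_diff_distrib left_diff_distrib E_diff E_scaleR star_mult star_star mult.assoc)
    from cpositive_add[OF this E_star_mult_E_le[of "p\<^sup>\<star> * x"]] show ?thesis by simp
  qed
  have upper: "cpositive (c *\<^sub>R E (x\<^sup>\<star> * x) - E (x\<^sup>\<star> * T x))" for x
  proof -
    have "cpositive (2 *\<^sub>R E (x\<^sup>\<star> * x) +
      (\<Sum>p\<leftarrow>ps. (norm p)\<^sup>2 *\<^sub>R E (x\<^sup>\<star> * x) - (E (p\<^sup>\<star> * x))\<^sup>\<star> * E (p\<^sup>\<star> * x)))"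
      by (intro cpositive_add cpositive_scaleR cpositive_sum_list single E_cpositive cpositive_star_mult_self) simp
    moreover have "(\<Sum>p\<leftarrow>ps. (norm p)\<^sup>2 *\<^sub>R y) = (\<Sum>p\<leftarrow>ps. (norm p)\<^sup>2) *\<^sub>R y" for y :: 'a
      by (induction ps) (simp_all add: scaleR_add_left)
    ultimately show ?thesis
      by (simp add: ET sum_list_subtractf c_def scaleR_add_left add_diff_eq)
  qed
  have "cpositive (E (x\<^sup>\<star> * endo_apply S x))" for x
  proof -
    have "E (x\<^sup>\<star> * endo_apply S x) = (1 / c) *\<^sub>R (c *\<^sub>R E (x\<^sup>\<star> * x) - E (x\<^sup>\<star> * T x))"
      using c by (simp add: ES scaleR_diff_right)
    then show ?thesis using upper[of x] c by (simp add: cpositive_scaleR)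
  qed
  moreover have "cpositive (r *\<^sub>R E (x\<^sup>\<star> * x) - E (x\<^sup>\<star> * endo_apply S x))" for x
  proof -
    have "r *\<^sub>R E (x\<^sup>\<star> * x) - E (x\<^sup>\<star> * endo_apply S x) = (1 / c) *\<^sub>R (E (x\<^sup>\<star> * T x) - E (x\<^sup>\<star> * x))"
      by (simp add: ES r_def scaleR_diff_right scaleR_diff_left)
    then show ?thesis using lower[of x] c by (simp add: cpositive_scaleR ET)
  qed
  ultimately have "norm (S ^ k) \<le> sqrt n * r ^ k" for k
    by (rule E_form_power_bound[OF sa r(1)])
  then have s: "binomial_summable a S" if "-1 \<le> a" "a \<le> 0" for a
    using that r by (intro binomial_summable_geometric[of a r S "sqrt n"]) auto
  define U where "U = binomial_series (-1/2) S"
  have s2: "binomial_summable (-1/2) S" by (rule s) simp_all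
  have "U * U * (1 - S) = 1"
    using binomial_series_mult[OF s2 s2] binomial_series_mult[OF s[of "-1"] binomial_summable_1]
    by (simp add: U_def binomial_series_1 binomial_series_0)
  moreover have "(1 - S) * U = U * (1 - S)"
    unfolding U_def by (rule binomial_series_commute[OF s2]) (simp add: algebra_simps)
  ultimately have "U * (1 - S) * U = 1" by (simp add: mult.assoc)
  then have "endo_apply (U * (1 - S) * U) x = x" for x by simp
  then have UTU: "endo_apply U ((1 / c) *\<^sub>R T (endo_apply U x)) = x" for x by (simp add: S)
  have lin: "linear (endo_apply U)" using bounded_linear_endo_apply by (rule bounded_linear.linear)
  have "T (x * b) = T x * b" if "b \<in> fixed" for x b
  proof -
    have "E (p\<^sup>\<star> * (x * b)) = E (p\<^sup>\<star> * x) * b" for p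
      using E_mult_right[OF that, of "p\<^sup>\<star> * x"] by (simp add: mult.assoc)
    then show ?thesis by (simp add: T_def sum_list_mult_const[symmetric] mult.assoc)
  qed
  then have "right_linear S" by (simp add: right_linear_def S left_diff_distrib)
  then have U: "endo_apply U (x * b) = endo_apply U x * b" if "b \<in> fixed" for x b
    using right_linear_binomial_series[OF s2] that by (simp add: right_linear_def U_def)
  have Usa: "E (x\<^sup>\<star> * endo_apply U y) = E ((endo_apply U x)\<^sup>\<star> * y)" for x y
    using E_selfadjoint_binomial_series[OF s2 sa] by (simp add: E_selfadjoint_def U_def)
  have sum: "endo_apply U (\<Sum>p\<leftarrow>L. h p) = (\<Sum>p\<leftarrow>L. endo_apply U (h p))" for h :: "'a \<Rightarrow> 'a" and L
    by (induction L) (simp_all add: linear_add[OF lin] linear_0[OF lin])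
  have "x = (\<Sum>u\<leftarrow>map (\<lambda>p. (1 / sqrt c) *\<^sub>R endo_apply U p) ps. u * E (u\<^sup>\<star> * x))" for x
  proof -
    have "(1 / c) *\<^sub>R y = (1 / sqrt c) *\<^sub>R (1 / sqrt c) *\<^sub>R y" for y :: 'a
      using c by simp
    moreover have "r *\<^sub>R (\<Sum>p\<leftarrow>L. h p) = (\<Sum>p\<leftarrow>L. r *\<^sub>R h p)" for r and h :: "'a \<Rightarrow> 'a" and L
      by (induction L) (simp_all add: scaleR_add_right)
    ultimately have "(\<Sum>u\<leftarrow>map (\<lambda>p. (1 / sqrt c) *\<^sub>R endo_apply U p) ps. u * E (u\<^sup>\<star> * x))
      = (1 / c) *\<^sub>R (\<Sum>p\<leftarrow>ps. endo_apply U p * E ((endo_apply U p)\<^sup>\<star> * x))"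
      using c by (simp add: comp_def star_scaleR E_scaleR)
    \<comment> \<open>Right linearity pulls the first \<open>U\<close> out of the sum;
      self-adjointness moves the second one onto \<open>x\<close>.\<close>
    also have "\<dots> = endo_apply U ((1 / c) *\<^sub>R T (endo_apply U x))"
      by (simp add: T_def sum linear_scale[OF lin] U Usa)
    finally show ?thesis by (simp add: UTU)
  qed
  then show ?thesis by (rule that)
qed

text \<open>The operator \<open>x \<mapsto> \<Sum>u\<leftarrow>us. u E(u\<^sup>\<star>x)\<close> does not determine its coefficients, but a frame
  acts as a unit on the ideal generated by \<open>e\<close>, which contains elements close to \<open>1\<close>.\<close>

lemma frame_coefficients:
  assumes approx: "\<And>\<epsilon>. \<epsilon> > 0 \<Longrightarrow> \<exists>L. \<forall>g\<in>carrier G. norm (delta g - coef L g) < \<epsilon>"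
    and frame: "\<And>x. x = (\<Sum>u\<leftarrow>us. u * E (u\<^sup>\<star> * x))" and k: "k \<in> carrier G"
  shows "(\<Sum>u\<leftarrow>us. u * \<alpha> k (u\<^sup>\<star>)) = n *\<^sub>R delta k"
proof -
  define Q where "Q g = coef (map (\<lambda>u. (u, u\<^sup>\<star>)) us) g" for g
  have Q: "(\<Sum>g\<in>carrier G. Q g * \<alpha> g x) = n *\<^sub>R x" for x
    unfolding Q_def sum_coef_\<alpha> by (simp add: comp_def frame[symmetric])
  \<comment> \<open>Left multiplication by the element \<open>Q\<close> affects only the first
    entries of \<open>L\<close>, and on those it is the operator evaluated in \<open>Q\<close>, that
    is, multiplication by \<open>n\<close>.\<close>
  have Qcoef: "(\<Sum>g\<in>carrier G. Q g * \<alpha> g (coef L (inv g \<otimes> k))) = n *\<^sub>R coef L k" for L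
  proof -
    have "(\<Sum>g\<in>carrier G. Q g * \<alpha> g (coef L (inv g \<otimes> k)))
        = (\<Sum>g\<in>carrier G. \<Sum>p\<leftarrow>L. (Q g * \<alpha> g (fst p)) * \<alpha> k (snd p))"
      using k by (intro sum.cong)
        (simp_all add: coef_def \<alpha>_sum_list \<alpha>_mult \<alpha>_comp m_assoc[symmetric] sum_list_const_mult[symmetric] mult.assoc)
    also have "\<dots> = (\<Sum>p\<leftarrow>L. n *\<^sub>R (fst p * \<alpha> k (snd p)))"
      unfolding sum_list_sum_swap[symmetric] sum_distrib_right[symmetric] Q by simp
    also have "\<dots> = n *\<^sub>R coef L k"
      unfolding coef_def by (induction L) (simp_all add: scaleR_add_right)
    finally show ?thesis .
  qed
  have Qdelta: "(\<Sum>g\<in>carrier G. Q g * \<alpha> g (delta (inv g \<otimes> k))) = Q k"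
    using sum_mult_\<alpha>_delta[OF k, of Q 1] k by simp
  \<comment> \<open>Two errors occur, one weighted by the norms of the \<open>Q g\<close> and one by
    \<open>n\<close>; with precision \<open>e / K\<close> they add up to \<open>e\<close>.\<close>
  define K where "K = (\<Sum>g\<in>carrier G. norm (Q g)) + n"
  have K: "K > 0" unfolding K_def by (intro add_nonneg_pos sum_nonneg) simp_all
  have "norm (Q k - n *\<^sub>R delta k) \<le> 0 + e" if e: "e > 0" for e
  proof -
    obtain L where L: "\<forall>g\<in>carrier G. norm (delta g - coef L g) < e / K"
      using approx[of "e / K"] e K by auto
    have "Q k - n *\<^sub>R coef L k = (\<Sum>g\<in>carrier G. Q g * \<alpha> g (delta (inv g \<otimes> k) - coef L (inv g \<otimes> k)))"
      unfolding Qcoef[symmetric] by (subst Qdelta[symmetric]) (simp add: \<alpha>_diff right_diff_distrib sum_subtractf)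
    also have "norm \<dots> \<le> (\<Sum>g\<in>carrier G. norm (Q g) * (e / K))"
    proof (rule sum_norm_le)
      fix g assume g: "g \<in> carrier G"
      let ?d = "delta (inv g \<otimes> k) - coef L (inv g \<otimes> k)"
      have "norm (Q g * \<alpha> g ?d) \<le> norm (Q g) * norm (\<alpha> g ?d)" by (rule norm_mult_ineq)
      also have "\<dots> \<le> norm (Q g) * (e / K)"
        using L g k by (intro mult_left_mono) (auto intro: less_imp_le)
      finally show "norm (Q g * \<alpha> g ?d) \<le> norm (Q g) * (e / K)" .
    qed
    finally have "norm (Q k - n *\<^sub>R coef L k) \<le> (\<Sum>g\<in>carrier G. norm (Q g)) * (e / K)"
      by (simp only: sum_distrib_right)
    moreover have "norm (n *\<^sub>R (delta k - coef L k)) \<le> n * (e / K)"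
      using mult_left_mono[of "norm (delta k - coef L k)" "e / K" n] L k by (simp add: less_imp_le)
    moreover have "norm (Q k - n *\<^sub>R delta k) \<le> norm (Q k - n *\<^sub>R coef L k) + norm (n *\<^sub>R (delta k - coef L k))"
      using norm_triangle_ineq4[of "Q k - n *\<^sub>R coef L k" "n *\<^sub>R (delta k - coef L k)"]
      by (simp add: scaleR_diff_right)
    moreover have "(\<Sum>g\<in>carrier G. norm (Q g)) * (e / K) + n * (e / K) = e"
      using K unfolding distrib_right[symmetric] K_def[symmetric] by simp
    ultimately show ?thesis by linarith
  qed
  then have "norm (Q k - n *\<^sub>R delta k) \<le> 0" by (rule field_le_epsilon)
  then show ?thesis by (simp add: Q_def coef_def comp_def)
qed

lemma tight_frame_of_approx:
  assumes "\<And>\<epsilon>. \<epsilon> > 0 \<Longrightarrow> \<exists>L. \<forall>g\<in>carrier G. norm (delta g - coef L g) < \<epsilon>"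
  shows "\<exists>us. \<forall>g\<in>carrier G. (\<Sum>u\<leftarrow>us. u * \<alpha> g (u\<^sup>\<star>)) = n *\<^sub>R delta g"
proof -
  obtain L where L: "\<And>x. x = (\<Sum>p\<leftarrow>L. fst p * E (snd p * x))"
    using exact_frame[OF assms] by blast
  obtain ps where ps: "\<And>x. cpositive ((\<Sum>p\<leftarrow>ps. (E (p\<^sup>\<star> * x))\<^sup>\<star> * E (p\<^sup>\<star> * x)) - E (x\<^sup>\<star> * x))"
    using lower_frame_bound[OF L] by blast
  obtain us where "\<And>x. x = (\<Sum>u\<leftarrow>us. u * E (u\<^sup>\<star> * x))"
    using tight_frame[OF ps] by blast
  then show ?thesis using frame_coefficients[OF assms] by blast
qed

section \<open>Elements of the crossed product\<close>

text \<open>The operator \<Sum> x_g \<lambda>_g in the regular representation. Questions about spans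
  and ideals of operators thereby become questions about coefficient functions, of which only the
  values on the carrier matter.\<close>

definition cp :: "('g \<Rightarrow> 'a) \<Rightarrow> ('g, 'a) operator" where
  "cp x = (\<lambda>\<xi> h. if h \<in> carrier G then \<Sum>g\<in>carrier G. \<alpha> (inv h) (x g) * \<xi> (inv g \<otimes> h) else 0)"

definition convolution :: "('g \<Rightarrow> 'a) \<Rightarrow> ('g \<Rightarrow> 'a) \<Rightarrow> 'g \<Rightarrow> 'a" where
  "convolution x y k = (\<Sum>g\<in>carrier G. x g * \<alpha> g (y (inv g \<otimes> k)))"

lemma cp_cong: "(\<And>g. g \<in> carrier G \<Longrightarrow> x g = y g) \<Longrightarrow> cp x = cp y"
  by (auto simp: cp_def fun_eq_iff intro!: sum.cong)

lemma cp_zero: "cp (\<lambda>g. 0) = 0"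
  by (auto simp: cp_def fun_eq_iff)

lemma cp_add: "cp x + cp y = cp (\<lambda>g. x g + y g)"
  by (auto simp: cp_def fun_eq_iff \<alpha>_add distrib_right sum.distrib)

lemma cp_diff: "cp x - cp y = cp (\<lambda>g. x g - y g)"
  by (auto simp: cp_def fun_eq_iff \<alpha>_diff left_diff_distrib sum_subtractf)

lemma cp_scaleC: "op_scaleC c (cp x) = cp (\<lambda>g. c *\<^sub>C x g)"
  by (auto simp: cp_def fun_eq_iff op_scaleC_def scaleC_sum_right \<alpha>_scaleC scaleC_mult_left)

lemma cp_comp: "cp x \<circ> cp y = cp (convolution x y)"
proof (intro ext)
  fix \<xi> h
  show "(cp x \<circ> cp y) \<xi> h = cp (convolution x y) \<xi> h"
  proof (cases "h \<in> carrier G")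
    case h: True
    have "(cp x \<circ> cp y) \<xi> h = (\<Sum>g\<in>carrier G. \<alpha> (inv h) (x g) *
        (\<Sum>k\<in>carrier G. \<alpha> (inv h \<otimes> g) (y k) * \<xi> (inv k \<otimes> (inv g \<otimes> h))))"
      using h by (auto simp: cp_def inv_mult_group intro!: sum.cong)
    \<comment> \<open>The substitution \<open>l = g \<otimes> k\<close> makes the argument of
      \<open>\<xi>\<close> independent of \<open>g\<close>.\<close>
    also have "\<dots> = (\<Sum>g\<in>carrier G. \<alpha> (inv h) (x g) *
        (\<Sum>l\<in>carrier G. \<alpha> (inv h \<otimes> g) (y (inv g \<otimes> l)) * \<xi> (inv l \<otimes> h)))"
    proof (rule sum.cong[OF refl])
      fix g assume g: "g \<in> carrier G"
      have eq: "inv (inv g \<otimes> l) \<otimes> (inv g \<otimes> h) = inv l \<otimes> h" if "l \<in> carrier G" for l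
      proof -
        have "inv (inv g \<otimes> l) \<otimes> (inv g \<otimes> h) = inv l \<otimes> ((g \<otimes> inv g) \<otimes> h)"
          using g h that by (simp only: inv_mult_group inv_inv inv_closed m_closed m_assoc)
        then show ?thesis using g h that by simp
      qed
      have "(\<Sum>k\<in>carrier G. \<alpha> (inv h \<otimes> g) (y k) * \<xi> (inv k \<otimes> (inv g \<otimes> h)))
        = (\<Sum>l\<in>carrier G. \<alpha> (inv h \<otimes> g) (y (inv g \<otimes> l)) * \<xi> (inv l \<otimes> h))"
        unfolding sum_translate[OF inv_closed[OF g],
            of "\<lambda>k. \<alpha> (inv h \<otimes> g) (y k) * \<xi> (inv k \<otimes> (inv g \<otimes> h))", symmetric]
        by (intro sum.cong refl) (simp only: eq)
      then show "\<alpha> (inv h) (x g) * (\<Sum>k\<in>carrier G. \<alpha> (inv h \<otimes> g) (y k) * \<xi> (inv k \<otimes> (inv g \<otimes> h)))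
        = \<alpha> (inv h) (x g) * (\<Sum>l\<in>carrier G. \<alpha> (inv h \<otimes> g) (y (inv g \<otimes> l)) * \<xi> (inv l \<otimes> h))"
        by (simp only:)
    qed
    also have "\<dots> = (\<Sum>g\<in>carrier G. \<Sum>l\<in>carrier G. \<alpha> (inv h) (x g * \<alpha> g (y (inv g \<otimes> l))) * \<xi> (inv l \<otimes> h))"
      using h by (intro sum.cong refl) (simp add: sum_distrib_left \<alpha>_mult \<alpha>_comp mult.assoc)
    also have "\<dots> = cp (convolution x y) \<xi> h"
      using h by (subst sum.swap) (simp add: cp_def convolution_def \<alpha>_sum sum_distrib_right)
    finally show ?thesis .
  qed (simp add: cp_def)
qed

lemma cp_single:
  assumes "g \<in> carrier G"
  shows "reg_rep G \<alpha> a \<circ> reg_unitary G g = cp (\<lambda>k. if k = g then a else 0)"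
proof -
  have "(\<Sum>k\<in>carrier G. \<alpha> (inv h) (if k = g then a else 0) * \<xi> (inv k \<otimes> h)) = \<alpha> (inv h) a * \<xi> (inv g \<otimes> h)"
    if "h \<in> carrier G" for h and \<xi> :: "'g \<Rightarrow> 'a"
  proof -
    have "(\<Sum>k\<in>carrier G. \<alpha> (inv h) (if k = g then a else 0) * \<xi> (inv k \<otimes> h))
        = (\<Sum>k\<in>carrier G. if k = g then \<alpha> (inv h) a * \<xi> (inv g \<otimes> h) else 0)"
      using that by (intro sum.cong) auto
    then show ?thesis using assms finite_carrier by simp
  qed
  then show ?thesis by (auto simp: fun_eq_iff cp_def reg_rep_def reg_unitary_def)
qed

lemma cp_sum: "(\<Sum>i\<in>A. cp (x i)) = cp (\<lambda>g. \<Sum>i\<in>A. x i g)"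
  by (induction A rule: infinite_finite_induct) (simp_all add: cp_zero cp_add)

lemma cp_eq_sum: "cp x = (\<Sum>g\<in>carrier G. reg_rep G \<alpha> (x g) \<circ> reg_unitary G g)"
proof -
  have "(\<Sum>g\<in>carrier G. reg_rep G \<alpha> (x g) \<circ> reg_unitary G g)
      = cp (\<lambda>k. \<Sum>g\<in>carrier G. if k = g then x g else 0)"
    by (simp add: cp_single flip: cp_sum)
  also have "\<dots> = cp x" using finite_carrier by (intro cp_cong) simp
  finally show ?thesis ..
qed

lemma crossed_product_eq: "crossed_product G \<alpha> = range cp"
proof -
  interpret V: vector_space "op_scaleC :: complex \<Rightarrow> ('g, 'a) operator \<Rightarrow> _"
    by (rule vector_space_op_scaleC)
  show ?thesis unfolding crossed_product_def
  proof
    have "V.subspace (range cp)"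
      unfolding V.subspace_def using rangeI[of cp "\<lambda>g. 0"]
      by (auto simp only: cp_zero cp_add cp_scaleC)
    then show "V.span {reg_rep G \<alpha> x \<circ> reg_unitary G g |x g. g \<in> carrier G} \<subseteq> range cp"
      by (intro V.span_minimal) (auto simp: cp_single)
    show "range cp \<subseteq> V.span {reg_rep G \<alpha> x \<circ> reg_unitary G g |x g. g \<in> carrier G}"
    proof (rule image_subsetI)
      show "cp x \<in> V.span {reg_rep G \<alpha> x \<circ> reg_unitary G g |x g. g \<in> carrier G}" for x
        unfolding cp_eq_sum by (rule V.span_sum) (blast intro: V.span_base)
    qed
  qed
qed

lemma averaging_projection_eq: "averaging_projection G = cp (\<lambda>g. (1 / n) *\<^sub>R 1)"
proof -
  have "reg_unitary G g = cp (\<lambda>k. if k = g then 1 else 0)" if "g \<in> carrier G" for g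
    unfolding cp_single[OF that, symmetric]
    using that by (auto simp: fun_eq_iff reg_rep_def reg_unitary_def)
  then have "averaging_projection G = op_scaleC (complex_of_real (1 / n)) (\<Sum>g\<in>carrier G. cp (\<lambda>k. if k = g then 1 else 0))"
    by (simp add: averaging_projection_def)
  also have "\<dots> = cp (\<lambda>k. (1 / n) *\<^sub>R (\<Sum>g\<in>carrier G. if k = g then 1 else 0))"
    unfolding cp_sum cp_scaleC scaleC_of_real ..
  also have "\<dots> = cp (\<lambda>g. (1 / n) *\<^sub>R 1)" using finite_carrier by (intro cp_cong) simp
  finally show ?thesis .
qed

text \<open>Coefficients can be read off from one vector. This yields both their uniqueness and
  their control by the operator norm.\<close>

lemma cp_apply_delta:
  assumes "h \<in> carrier G"
  shows "cp x delta h = \<alpha> (inv h) (x h)"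
  using assms sum_mult_\<alpha>_delta[OF assms, of "\<lambda>g. \<alpha> (inv h) (x g)" 1]
  by (simp add: cp_def delta_def if_distrib[of "\<alpha> _"] cong: if_cong)

lemma cp_eq_iff: "cp x = cp y \<longleftrightarrow> (\<forall>g\<in>carrier G. x g = y g)"
proof
  assume "cp x = cp y"
  then have "\<alpha> (inv h) (x h) = \<alpha> (inv h) (y h)" if "h \<in> carrier G" for h
    using cp_apply_delta[OF that, of x] cp_apply_delta[OF that, of y] by simp
  then show "\<forall>g\<in>carrier G. x g = y g" by (metis \<alpha>_inverse(1))
qed (auto intro: cp_cong)

section \<open>Coefficients under the operator norm, and the closed ideal generated by
  \<open>e\<close>\<close>

lemma norm_le_l2_norm:
  assumes "h \<in> carrier G"
  shows "norm (\<xi> h) \<le> l2_norm G (\<xi> :: 'g \<Rightarrow> 'a)"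
proof -
  have "(norm (\<xi> h))\<^sup>2 \<le> norm (\<Sum>h\<in>carrier G. (\<xi> h)\<^sup>\<star> * \<xi> h)"
    using cpositive_sum_norm_le[OF finite_carrier cpositive_star_mult_self assms, of \<xi>]
    by (simp add: cstar_identity)
  then show ?thesis unfolding l2_norm_def by (rule real_le_rsqrt)
qed

lemma l2_norm_le:
  assumes "\<And>h. h \<in> carrier G \<Longrightarrow> norm (\<xi> h) \<le> K"
  shows "l2_norm G (\<xi> :: 'g \<Rightarrow> 'a) \<le> sqrt (n * K\<^sup>2)"
proof -
  have "norm (\<Sum>h\<in>carrier G. (\<xi> h)\<^sup>\<star> * \<xi> h) \<le> (\<Sum>h\<in>carrier G. K\<^sup>2)"
    using assms by (intro sum_norm_le) (simp add: cstar_identity power_mono)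
  then show ?thesis by (simp add: l2_norm_def card_carrier)
qed

lemma norm_le_op_norm:
  assumes k: "k \<in> carrier G"
  shows "norm (x k) \<le> op_norm G (cp x)"
proof -
  \<comment> \<open>A crude bound, whose purpose is to make the set in the supremum bounded above;
    otherwise the real-valued \<open>SUP\<close> says nothing.\<close>
  have "l2_norm G (cp x \<xi>) \<le> sqrt (n * (\<Sum>g\<in>carrier G. norm (x g))\<^sup>2)" if "l2_norm G \<xi> \<le> 1" for \<xi>
  proof (rule l2_norm_le)
    fix h assume h: "h \<in> carrier G"
    have "norm (\<Sum>g\<in>carrier G. \<alpha> (inv h) (x g) * \<xi> (inv g \<otimes> h)) \<le> (\<Sum>g\<in>carrier G. norm (x g))"
    proof (rule sum_norm_le)
      fix g assume g: "g \<in> carrier G"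
      have "norm (\<alpha> (inv h) (x g) * \<xi> (inv g \<otimes> h)) \<le> norm (x g) * norm (\<xi> (inv g \<otimes> h))"
        using norm_mult_ineq[of "\<alpha> (inv h) (x g)"] h by simp
      also have "\<dots> \<le> norm (x g) * 1"
        using norm_le_l2_norm[of "inv g \<otimes> h" \<xi>] that g h by (intro mult_left_mono) auto
      finally show "norm (\<alpha> (inv h) (x g) * \<xi> (inv g \<otimes> h)) \<le> norm (x g)" by simp
    qed
    then show "norm (cp x \<xi> h) \<le> (\<Sum>g\<in>carrier G. norm (x g))" using h by (simp add: cp_def)
  qed
  then have "bdd_above ((\<lambda>\<xi>. l2_norm G (cp x \<xi>)) ` {\<xi>. l2_norm G \<xi> \<le> 1})"
    by (auto intro!: bdd_aboveI)
  moreover have "l2_norm G delta \<le> 1"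
  proof -
    have "(\<Sum>h\<in>carrier G. (delta h)\<^sup>\<star> * delta h) = (\<Sum>h\<in>carrier G. if h = \<one> then 1 else 0)"
      by (intro sum.cong) (auto simp: delta_def)
    then show ?thesis using finite_carrier by (simp add: l2_norm_def)
  qed
  ultimately have "l2_norm G (cp x delta) \<le> op_norm G (cp x)"
    unfolding op_norm_def by (intro cSUP_upper) auto
  moreover have "norm (x k) \<le> l2_norm G (cp x delta)"
    using norm_le_l2_norm[OF k, of "cp x delta"] k by (simp add: cp_apply_delta)
  ultimately show ?thesis by linarith
qed

text \<open>Uniform closure on the carrier of the coefficient functions of the elements \<Sum> a e
  b. The factor |G| between these and \<open>coef\<close> can be absorbed into
  \<open>a\<close>.\<close>

definition approximable :: "('g \<Rightarrow> 'a) \<Rightarrow> bool" where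
  "approximable x \<longleftrightarrow> (\<forall>\<epsilon>>0. \<exists>L. \<forall>g\<in>carrier G. norm (x g - coef L g) < \<epsilon>)"

lemma coef_append: "coef (L @ L') g = coef L g + coef L' g"
  by (simp add: coef_def)

lemma approximable_zero: "approximable (\<lambda>g. 0)"
  unfolding approximable_def by (intro allI impI exI[of _ "[]"]) (simp add: coef_def)

lemma approximable_add:
  assumes "approximable x" "approximable y"
  shows "approximable (\<lambda>g. x g + y g)"
  unfolding approximable_def
proof (intro allI impI)
  fix \<epsilon> :: real assume "\<epsilon> > 0"
  then obtain L L' where L: "\<forall>g\<in>carrier G. norm (x g - coef L g) < \<epsilon>/2"
      "\<forall>g\<in>carrier G. norm (y g - coef L' g) < \<epsilon>/2"
    using assms unfolding approximable_def by (meson half_gt_zero)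
  have "norm (x g + y g - coef (L @ L') g) < \<epsilon>" if "g \<in> carrier G" for g
    using norm_triangle_ineq[of "x g - coef L g" "y g - coef L' g"] L that
    by (fastforce simp: coef_append algebra_simps)
  then show "\<exists>L. \<forall>g\<in>carrier G. norm (x g + y g - coef L g) < \<epsilon>" by blast
qed

lemma approximable_sum:
  "finite A \<Longrightarrow> (\<And>i. i \<in> A \<Longrightarrow> approximable (x i)) \<Longrightarrow> approximable (\<lambda>g. \<Sum>i\<in>A. x i g)"
  by (induction A rule: finite_induct) (simp_all add: approximable_zero approximable_add)

text \<open>The estimate at \<open>g\<close> may use another element \<open>h\<close>, since
  multiplication by group unitaries translates the coefficients.\<close>

lemma approximable_transform:
  assumes x: "approximable x" and K: "K > 0"
    and bound: "\<And>L. \<exists>L'. \<forall>g\<in>carrier G. \<exists>h\<in>carrier G. norm (y g - coef L' g) \<le> K * norm (x h - coef L h)"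
  shows "approximable y"
  unfolding approximable_def
proof (intro allI impI)
  fix \<epsilon> :: real assume "\<epsilon> > 0"
  then obtain L where L: "\<forall>g\<in>carrier G. norm (x g - coef L g) < \<epsilon> / K"
    using x K unfolding approximable_def by (meson divide_pos_pos)
  obtain L' where L': "\<forall>g\<in>carrier G. \<exists>h\<in>carrier G. norm (y g - coef L' g) \<le> K * norm (x h - coef L h)"
    using bound by blast
  have "norm (y g - coef L' g) < \<epsilon>" if g: "g \<in> carrier G" for g
  proof -
    obtain h where h: "h \<in> carrier G" "norm (y g - coef L' g) \<le> K * norm (x h - coef L h)"
      using bspec[OF L' g] by blast
    have "K * norm (x h - coef L h) < K * (\<epsilon> / K)"
      using L h K by (intro mult_strict_left_mono) auto
    then show ?thesis using h K by simp
  qed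
  then show "\<exists>L. \<forall>g\<in>carrier G. norm (y g - coef L g) < \<epsilon>" by blast
qed

text \<open>These are the coefficients after left multiplication by a \<lambda>_g. As \<lambda>_g e
  = e, it turns \<open>p e q\<close> into \<open>(a * \<alpha> g p) e q\<close>. The 1 in
  \<open>norm a + 1\<close> keeps the factor positive.\<close>

lemma approximable_left_mult:
  assumes x: "approximable x" and g: "g \<in> carrier G"
  shows "approximable (\<lambda>k. a * \<alpha> g (x (inv g \<otimes> k)))"
proof (rule approximable_transform[OF x, of "norm a + 1"])
  fix L
  show "\<exists>L'. \<forall>k\<in>carrier G. \<exists>h\<in>carrier G.
      norm (a * \<alpha> g (x (inv g \<otimes> k)) - coef L' k) \<le> (norm a + 1) * norm (x h - coef L h)"
  proof (intro exI ballI bexI)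
    fix k assume k: "k \<in> carrier G"
    let ?h = "inv g \<otimes> k"
    show h: "?h \<in> carrier G" using g k by simp
    have "coef (map (\<lambda>p. (a * \<alpha> g (fst p), snd p)) L) k = a * \<alpha> g (coef L ?h)"
      using g k by (simp add: coef_def comp_def sum_list_const_mult[symmetric] \<alpha>_sum_list \<alpha>_mult \<alpha>_comp
          m_assoc[symmetric] mult.assoc)
    then have "a * \<alpha> g (x ?h) - coef (map (\<lambda>p. (a * \<alpha> g (fst p), snd p)) L) k = a * \<alpha> g (x ?h - coef L ?h)"
      using g by (simp add: \<alpha>_diff right_diff_distrib)
    moreover have "norm (a * \<alpha> g (x ?h - coef L ?h)) \<le> norm a * norm (x ?h - coef L ?h)"
      using norm_mult_ineq[of a "\<alpha> g (x ?h - coef L ?h)"] g by simp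
    ultimately show "norm (a * \<alpha> g (x ?h) - coef (map (\<lambda>p. (a * \<alpha> g (fst p), snd p)) L) k)
        \<le> (norm a + 1) * norm (x ?h - coef L ?h)"
      by (simp add: distrib_right add_increasing2)
  qed
qed (simp add: add_nonneg_pos)

text \<open>These are the coefficients after right multiplication by b \<lambda>_l. As e \<lambda>_l
  = e, it turns \<open>p e q\<close> into \<open>p e (\<alpha> (inv l) (q * b))\<close>.\<close>

lemma approximable_right_mult:
  assumes x: "approximable x" and l: "l \<in> carrier G"
  shows "approximable (\<lambda>k. x (k \<otimes> inv l) * \<alpha> (k \<otimes> inv l) b)"
proof (rule approximable_transform[OF x, of "norm b + 1"])
  fix L
  show "\<exists>L'. \<forall>k\<in>carrier G. \<exists>h\<in>carrier G.
      norm (x (k \<otimes> inv l) * \<alpha> (k \<otimes> inv l) b - coef L' k) \<le> (norm b + 1) * norm (x h - coef L h)"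
  proof (intro exI ballI bexI)
    fix k assume k: "k \<in> carrier G"
    let ?h = "k \<otimes> inv l"
    let ?L = "map (\<lambda>p. (fst p, \<alpha> (inv l) (snd p * b))) L"
    show h: "?h \<in> carrier G" using l k by simp
    have "coef ?L k = coef L ?h * \<alpha> ?h b"
      using l k by (simp add: coef_def comp_def sum_list_mult_const[symmetric] \<alpha>_mult \<alpha>_comp mult.assoc)
    then have "x ?h * \<alpha> ?h b - coef ?L k = (x ?h - coef L ?h) * \<alpha> ?h b"
      by (simp add: left_diff_distrib)
    moreover have "norm ((x ?h - coef L ?h) * \<alpha> ?h b) \<le> norm (x ?h - coef L ?h) * norm b"
      using norm_mult_ineq[of "x ?h - coef L ?h" "\<alpha> ?h b"] h by simp
    ultimately show "norm (x ?h * \<alpha> ?h b - coef ?L k) \<le> (norm b + 1) * norm (x ?h - coef L ?h)"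
      by (simp add: distrib_right add_increasing2 mult.commute)
  qed
qed (simp add: add_nonneg_pos)

lemma approximable_scaleC:
  assumes "approximable x"
  shows "approximable (\<lambda>k. c *\<^sub>C x k)"
proof -
  have "approximable (\<lambda>k. (c *\<^sub>C 1) * \<alpha> \<one> (x (inv \<one> \<otimes> k)))"
    using assms by (rule approximable_left_mult) simp
  then show ?thesis by (simp add: approximable_def scaleC_mult_left)
qed

lemma approximable_convolution_right:
  assumes "approximable y"
  shows "approximable (convolution x y)"
proof -
  have "approximable (\<lambda>k. \<Sum>g\<in>carrier G. x g * \<alpha> g (y (inv g \<otimes> k)))"
    using assms by (intro approximable_sum finite_carrier approximable_left_mult)
  then show ?thesis by (simp add: convolution_def[abs_def])
qed

lemma approximable_convolution_left:
  assumes "approximable x"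
  shows "approximable (convolution x y)"
proof -
  have "convolution x y k = (\<Sum>l\<in>carrier G. x (k \<otimes> inv l) * \<alpha> (k \<otimes> inv l) (y l))" if k: "k \<in> carrier G" for k
    unfolding convolution_def
    by (rule sum.reindex_bij_witness[of _ "\<lambda>l. k \<otimes> inv l" "\<lambda>g. inv g \<otimes> k"])
      (use k in \<open>simp_all add: inv_mult_group m_assoc[symmetric], simp_all add: m_assoc\<close>)
  moreover have "approximable (\<lambda>k. \<Sum>l\<in>carrier G. x (k \<otimes> inv l) * \<alpha> (k \<otimes> inv l) (y l))"
    using assms by (intro approximable_sum finite_carrier approximable_right_mult)
  ultimately show ?thesis by (simp add: approximable_def)
qed

text \<open>Bounds the ideal generated by \<open>e\<close> from above. Closedness holds because
  convergence in operator norm forces uniform convergence of the coefficients.\<close>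

lemma closed_ideal_approximable: "closed_ideal G \<alpha> (cp ` {x. approximable x})"
proof -
  interpret V: vector_space "op_scaleC :: complex \<Rightarrow> ('g, 'a) operator \<Rightarrow> _"
    by (rule vector_space_op_scaleC)
  let ?J = "cp ` {x. approximable x}"
  have subspace: "V.subspace ?J"
    unfolding V.subspace_def using imageI[of "\<lambda>g. 0" "{x. approximable x}" cp]
    by (auto simp only: cp_zero cp_add cp_scaleC mem_Collect_eq
        intro!: imageI approximable_zero approximable_add approximable_scaleC)
  have limit: "S \<in> ?J" if S: "S \<in> range cp" and T: "\<And>i. T i \<in> ?J"
    and lim: "(\<lambda>i::nat. op_norm G (T i - S)) \<longlonglongrightarrow> 0" for T S
  proof -
    obtain x where x: "S = cp x" using S by blast
    have "\<forall>i. \<exists>z. T i = cp z \<and> approximable z" using T by blast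
    then obtain z where z: "\<And>i. T i = cp (z i)" "\<And>i. approximable (z i)" by metis
    have "approximable x"
      unfolding approximable_def
    proof (intro allI impI)
      fix \<epsilon> :: real assume e: "\<epsilon> > 0"
      then obtain i where i: "norm (op_norm G (T i - S) - 0) < \<epsilon>/2"
        using lim LIMSEQ_D[OF lim, of "\<epsilon>/2"] by auto
      obtain L where L: "\<forall>g\<in>carrier G. norm (z i g - coef L g) < \<epsilon>/2"
        using z(2)[of i] e unfolding approximable_def by (meson half_gt_zero)
      have "norm (x g - coef L g) < \<epsilon>" if g: "g \<in> carrier G" for g
      proof -
        have "norm (z i g - x g) < \<epsilon>/2"
          using norm_le_op_norm[OF g, of "\<lambda>g. z i g - x g"] i by (simp add: x z cp_diff)
        moreover have "norm (z i g - coef L g) < \<epsilon>/2" using L g by blast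
        moreover have "norm (x g - coef L g) \<le> norm (z i g - x g) + norm (z i g - coef L g)"
          using norm_triangle_ineq4[of "z i g - coef L g" "z i g - x g"] by simp
        ultimately show ?thesis by linarith
      qed
      then show "\<exists>L. \<forall>g\<in>carrier G. norm (x g - coef L g) < \<epsilon>" by blast
    qed
    then show ?thesis using x by blast
  qed
  show ?thesis
    unfolding closed_ideal_def crossed_product_eq
  proof (intro conjI)
    show "\<forall>S\<in>range cp. \<forall>T\<in>?J. S \<circ> T \<in> ?J \<and> T \<circ> S \<in> ?J"
      by (auto simp: cp_comp approximable_convolution_left approximable_convolution_right)
    show "\<forall>T. \<forall>S\<in>range cp. (\<forall>n. T n \<in> ?J) \<and> (\<lambda>n::nat. op_norm G (T n - S)) \<longlonglongrightarrow> 0 \<longrightarrow> S \<in> ?J"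
      using limit by blast
  qed (use subspace in blast)+
qed

lemma averaging_projection_approximable: "averaging_projection G \<in> cp ` {x. approximable x}"
proof -
  have "coef [((1 / n) *\<^sub>R 1, 1)] g = (1 / n) *\<^sub>R 1" if "g \<in> carrier G" for g
    using that by (simp add: coef_def)
  then have "approximable (\<lambda>g. (1 / n) *\<^sub>R 1)"
    unfolding approximable_def by (intro allI impI exI[of _ "[((1 / n) *\<^sub>R 1, 1)]"]) simp
  then show ?thesis unfolding averaging_projection_eq by blast
qed

lemma approximable_delta_of_saturated:
  assumes "saturated G \<alpha>"
  shows "approximable delta"
proof -
  have "cp delta \<in> averaging_ideal G \<alpha>"
    using assms by (simp add: saturated_def crossed_product_eq)
  then have "cp delta \<in> cp ` {x. approximable x}"
    unfolding averaging_ideal_def using closed_ideal_approximable averaging_projection_approximable by blast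
  then show ?thesis by (auto simp: cp_eq_iff approximable_def)
qed

text \<open>The bound from below: the coefficients are those of \<Sum> a e b, with (a, b) ranging
  over \<open>L\<close>, and these elements lie in every ideal containing \<open>e\<close>.\<close>

lemma averaging_ideal_contains:
  assumes I: "closed_ideal G \<alpha> I" "averaging_projection G \<in> I"
  shows "cp (\<lambda>g. (1 / n) *\<^sub>R coef L g) \<in> I"
proof -
  interpret V: vector_space "op_scaleC :: complex \<Rightarrow> ('g, 'a) operator \<Rightarrow> _"
    by (rule vector_space_op_scaleC)
  have sub: "V.subspace I" and ideal: "\<And>x T. T \<in> I \<Longrightarrow> cp x \<circ> T \<in> I \<and> T \<circ> cp x \<in> I"
    using I(1) by (auto simp: closed_ideal_def crossed_product_eq)
  show ?thesis
  proof (induction L)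
    case Nil
    then show ?case using V.subspace_0[OF sub] by (simp only: coef_def list.map sum_list.Nil scaleR_zero_right cp_zero)
  next
    case (Cons p L)
    obtain a b where p: "p = (a, b)" by fastforce
    \<comment> \<open>The outer factors are the elements \<open>a\<close> and \<open>b\<close> of
      \<open>M\<close>, with coefficients concentrated at the identity.\<close>
    have I': "cp (\<lambda>g. delta g * a) \<circ> averaging_projection G \<circ> cp (\<lambda>g. b * delta g) \<in> I"
      using ideal I(2) by blast
    have "convolution (\<lambda>g. delta g * a) (\<lambda>g. (1 / n) *\<^sub>R 1) k = (1 / n) *\<^sub>R a" for k
    proof -
      have "convolution (\<lambda>g. delta g * a) (\<lambda>g. (1 / n) *\<^sub>R 1) k = (\<Sum>g\<in>carrier G. if g = \<one> then (1 / n) *\<^sub>R a else 0)"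
        unfolding convolution_def by (intro sum.cong) (auto simp: delta_def \<alpha>_scaleR)
      then show ?thesis using finite_carrier by simp
    qed
    then have c1: "convolution (\<lambda>g. delta g * a) (\<lambda>g. (1 / n) *\<^sub>R 1) = (\<lambda>g. (1 / n) *\<^sub>R a)" by (rule ext)
    have "cp (convolution (\<lambda>g. (1 / n) *\<^sub>R a) (\<lambda>g. b * delta g)) = cp (\<lambda>g. (1 / n) *\<^sub>R (a * \<alpha> g b))"
      by (rule cp_cong) (simp only: convolution_def sum_mult_\<alpha>_delta, simp)
    with I' have "cp (\<lambda>g. (1 / n) *\<^sub>R (a * \<alpha> g b)) \<in> I"
      unfolding averaging_projection_eq cp_comp c1 by (simp only:)
    from V.subspace_add[OF sub this Cons.IH] show ?case
      by (simp add: cp_add coef_def p scaleR_add_right)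
  qed
qed

lemma saturated_of_tight_frame:
  assumes us: "\<forall>g\<in>carrier G. (\<Sum>u\<leftarrow>us. u * \<alpha> g (u\<^sup>\<star>)) = n *\<^sub>R delta g"
  shows "saturated G \<alpha>"
proof -
  have "cp x \<in> I" if I: "closed_ideal G \<alpha> I" "averaging_projection G \<in> I" for x I
  proof -
    have "cp (\<lambda>g. (1 / n) *\<^sub>R coef (map (\<lambda>u. (u, u\<^sup>\<star>)) us) g) \<in> I"
      by (rule averaging_ideal_contains[OF I])
    also have "cp (\<lambda>g. (1 / n) *\<^sub>R coef (map (\<lambda>u. (u, u\<^sup>\<star>)) us) g) = cp delta"
      using us by (intro cp_cong) (simp add: coef_def comp_def)
    finally have "cp x \<circ> cp delta \<in> I"
      using I(1) by (auto simp: closed_ideal_def crossed_product_eq)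
    moreover have "cp x \<circ> cp delta = cp x"
      unfolding cp_comp using sum_mult_\<alpha>_delta[of _ x 1] by (intro cp_cong) (simp add: convolution_def)
    ultimately show ?thesis by simp
  qed
  then have "range cp \<subseteq> averaging_ideal G \<alpha>" unfolding averaging_ideal_def by blast
  \<comment> \<open>An intersection over an empty family would be everything; the ideal of
    approximable coefficient functions is a member.\<close>
  moreover have "averaging_ideal G \<alpha> \<subseteq> range cp"
    unfolding averaging_ideal_def
    using closed_ideal_approximable averaging_projection_approximable by blast
  ultimately show ?thesis by (simp add: saturated_def crossed_product_eq)
qed

section \<open>The canonical expectation\<close>

lemma bounded_linear_\<alpha>: "g \<in> carrier G \<Longrightarrow> bounded_linear (\<alpha> g)"
  by (rule bounded_linear_intro[of _ 1]) (simp_all add: \<alpha>_add \<alpha>_scaleR)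

lemma unital_cstar_subalgebra_fixed: "unital_cstar_subalgebra fixed"
proof -
  interpret V: vector_space "scaleC :: complex \<Rightarrow> 'a \<Rightarrow> 'a" by (rule vector_space_scaleC)
  have "fixed = (\<Inter>g\<in>carrier G. {x. \<alpha> g x = x})" by (auto simp: fixed_point_algebra_def)
  also have "closed \<dots>"
    by (intro closed_INT ballI closed_Collect_eq linear_continuous_on bounded_linear_\<alpha> continuous_on_id)
  finally have "closed fixed" .
  moreover have "V.subspace fixed"
    by (auto simp: V.subspace_def fixed_point_algebra_def \<alpha>_add \<alpha>_scaleC)
  ultimately show ?thesis
    by (simp add: unital_cstar_subalgebra_def star_fixed)
      (simp add: fixed_point_algebra_def \<alpha>_mult)
qed

lemma faithful_E: "faithful_conditional_expectation fixed E"
proof -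
  have "range E = fixed" using E_fixed E_in_fixed by (metis image_subset_iff rangeI subsetI subset_antisym)
  then have "conditional_expectation fixed E"
    by (simp add: conditional_expectation_def unital_cstar_subalgebra_fixed Vector_Spaces.linear_iff
        vector_space_scaleC E_add E_scaleC E_fixed E_mult_left E_mult_right positive_element_iff
        E_cpositive cpositive_star_mult_self)
  moreover have "x = 0" if "E (x\<^sup>\<star> * x) = 0" for x
    using norm_square_le_E[of x] that by simp
  ultimately show ?thesis unfolding faithful_conditional_expectation_def by blast
qed

text \<open>The first reconstruction formula for \<open>b\<close> is the adjoint of the second one
  for \<open>b\<^sup>\<star>\<close>. Quasi-bases are indexed from 1 and lists from 0, hence
  \<open>i - 1\<close>.\<close>

lemma quasi_basis_of_tight_frame:
  assumes us: "\<forall>g\<in>carrier G. (\<Sum>u\<leftarrow>us. u * \<alpha> g (u\<^sup>\<star>)) = n *\<^sub>R delta g"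
  shows "quasi_basis E (length us) (\<lambda>i. us ! (i - 1))"
proof -
  have frame: "(\<Sum>u\<leftarrow>us. u * E (u\<^sup>\<star> * b)) = b" for b
  proof -
    have "n *\<^sub>R (\<Sum>u\<leftarrow>us. u * E (u\<^sup>\<star> * b)) = (\<Sum>g\<in>carrier G. n *\<^sub>R (delta g * \<alpha> g b))"
      using sum_coef_\<alpha>[of "map (\<lambda>u. (u, u\<^sup>\<star>)) us" b] us by (simp add: coef_def comp_def)
    also have "\<dots> = n *\<^sub>R b" by (simp only: scaleR_sum_right[symmetric] sum_delta_\<alpha>)
    finally show ?thesis by simp
  qed
  have "(\<Sum>u\<leftarrow>us. E (b * u) * u\<^sup>\<star>) = (\<Sum>u\<leftarrow>us. u * E (u\<^sup>\<star> * b\<^sup>\<star>))\<^sup>\<star>" for b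
    by (simp add: star_sum_list comp_def star_mult E_star[symmetric] star_star)
  then have frame': "(\<Sum>u\<leftarrow>us. E (b * u) * u\<^sup>\<star>) = b" for b by (simp add: frame star_star)
  show ?thesis
    unfolding quasi_basis_def sum_nth_eq_sum_list[of "\<lambda>u. u * E (u\<^sup>\<star> * _)"]
      sum_nth_eq_sum_list[of "\<lambda>u. E (_ * u) * u\<^sup>\<star>"] frame frame' by simp
qed

text \<open>The coefficients \<open>Q\<close> of \<open>|G| \<Sum>u\<leftarrow>us. u e u\<^sup>\<star>\<close>, which is \<open>|G|\<close> times a projection, satisfy
  \<open>\<Sum>g. Q\<^sub>g Q\<^sub>g\<^sup>\<star> = |G| Q\<^sub>\<iota> = |G|\<^sup>2\<close>, so that the term at \<open>\<iota>\<close> exhausts the sum.\<close>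

lemma tight_frame_of_index:
  assumes frame: "\<And>x. x = (\<Sum>u\<leftarrow>us. u * E (u\<^sup>\<star> * x))"
    and index: "(\<Sum>u\<leftarrow>us. u * u\<^sup>\<star>) = n *\<^sub>R 1" and k: "k \<in> carrier G"
  shows "(\<Sum>u\<leftarrow>us. u * \<alpha> k (u\<^sup>\<star>)) = n *\<^sub>R delta k"
proof -
  define Q where "Q g = coef (map (\<lambda>u. (u, u\<^sup>\<star>)) us) g" for g
  have Q: "(\<Sum>g\<in>carrier G. Q g * \<alpha> g x) = n *\<^sub>R x" for x
    unfolding Q_def sum_coef_\<alpha> by (simp add: comp_def frame[symmetric])
  have Q1: "Q \<one> = n *\<^sub>R 1" using index by (simp add: Q_def coef_def comp_def)
  have "(\<Sum>g\<in>carrier G. Q g * (Q g)\<^sup>\<star>) = (\<Sum>g\<in>carrier G. \<Sum>u\<leftarrow>us. Q g * \<alpha> g u * u\<^sup>\<star>)"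
  proof (intro sum.cong refl)
    fix g assume g: "g \<in> carrier G"
    have "(Q g)\<^sup>\<star> = (\<Sum>u\<leftarrow>us. \<alpha> g u * u\<^sup>\<star>)"
      using g by (simp add: Q_def coef_def star_sum_list comp_def star_mult star_star \<alpha>_star)
    then show "Q g * (Q g)\<^sup>\<star> = (\<Sum>u\<leftarrow>us. Q g * \<alpha> g u * u\<^sup>\<star>)"
      by (simp add: sum_list_const_mult[symmetric] mult.assoc)
  qed
  also have "\<dots> = (\<Sum>u\<leftarrow>us. n *\<^sub>R (u * u\<^sup>\<star>))"
    unfolding sum_list_sum_swap[symmetric] sum_distrib_right[symmetric] Q by simp
  also have "\<dots> = n *\<^sub>R (\<Sum>u\<leftarrow>us. u * u\<^sup>\<star>)"
    by (induction us) (simp_all add: scaleR_add_right)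
  also have "\<dots> = Q \<one> * (Q \<one>)\<^sup>\<star>"
    by (simp add: index Q1 star_scaleR)
  finally have sum: "(\<Sum>g\<in>carrier G - {\<one>}. Q g * (Q g)\<^sup>\<star>) = 0"
    using finite_carrier by (simp add: sum.remove[of _ \<one>])
  have "Q k = 0" if "k \<noteq> \<one>"
  proof -
    have pos: "cpositive (Q g * (Q g)\<^sup>\<star>)" for g
      using cpositive_star_mult_self[of "(Q g)\<^sup>\<star>"] by (simp add: star_star)
    have "norm (Q k * (Q k)\<^sup>\<star>) \<le> norm (\<Sum>g\<in>carrier G - {\<one>}. Q g * (Q g)\<^sup>\<star>)"
      using finite_carrier k that by (intro cpositive_sum_norm_le pos) auto
    then have "(norm (Q k))\<^sup>2 \<le> 0"
      unfolding sum using cstar_identity[of "(Q k)\<^sup>\<star>"] by (simp add: star_star)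
    then show ?thesis by simp
  qed
  then have "Q k = n *\<^sub>R delta k" using Q1 by (cases "k = \<one>") (simp_all add: delta_def)
  then show ?thesis by (simp add: Q_def coef_def comp_def)
qed

lemma tight_frame_of_quasi_basis:
  assumes v: "quasi_basis E m v" and index: "Index E = of_nat (order G)"
  shows "\<exists>us. \<forall>g\<in>carrier G. (\<Sum>u\<leftarrow>us. u * \<alpha> g (u\<^sup>\<star>)) = n *\<^sub>R delta g"
proof (intro exI ballI tight_frame_of_index)
  have sum: "(\<Sum>u\<leftarrow>map v [1..<Suc m]. f u) = (\<Sum>i=1..m. f (v i))" for f :: "'a \<Rightarrow> 'a"
    by (simp add: comp_def interv_sum_list_conv_sum_set_nat atLeastLessThanSuc_atLeastAtMost del: upt_Suc)
  show "x = (\<Sum>u\<leftarrow>map v [1..<Suc m]. u * E (u\<^sup>\<star> * x))" for x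
    unfolding sum using v by (simp add: quasi_basis_def)
  show "(\<Sum>u\<leftarrow>map v [1..<Suc m]. u * u\<^sup>\<star>) = n *\<^sub>R 1"
    unfolding sum using Index_eq[OF v] index by (simp add: scaleR_conv_of_real)
qed

section \<open>Covariant and almost covariant families\<close>

lemma covariant_family_of_tight_frame:
  assumes us: "\<forall>g\<in>carrier G. (\<Sum>u\<leftarrow>us. u * \<alpha> g (u\<^sup>\<star>)) = n *\<^sub>R delta g"
  shows "\<exists>m\<ge>1. \<exists>b :: nat \<Rightarrow> 'g \<Rightarrow> 'a.
    (\<forall>j\<in>{1..m}. \<forall>g\<in>carrier G. \<forall>h\<in>carrier G. \<alpha> g (b j h) = b j (g \<otimes> h)) \<and>
    (\<forall>g\<in>carrier G. \<forall>h\<in>carrier G. (\<Sum>j=1..m. b j g * (b j h)\<^sup>\<star>) = (if g = h then 1 else 0))"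
proof (intro exI conjI ballI)
  have "us \<noteq> []" using us[rule_format, OF one_closed] by (auto simp: delta_def)
  then show "length us \<ge> 1" by (cases us) auto
  \<comment> \<open>The orbit of each frame element is covariant by construction. Its orthogonality
    relation at \<open>g\<close>, \<open>h\<close> is the frame identity at
    \<open>inv g \<otimes> h\<close>, moved by \<open>\<alpha> g\<close>; the factor turns
    \<open>n\<close> into 1.\<close>
  define b where "b j g = (1 / sqrt n) *\<^sub>R \<alpha> g (us ! (j - 1))" for j g
  fix g h assume g: "g \<in> carrier G" and h: "h \<in> carrier G"
  show "\<alpha> g (b j h) = b j (g \<otimes> h)" for j
    using g h by (simp add: b_def \<alpha>_scaleR \<alpha>_comp)
  have "b j g * (b j h)\<^sup>\<star> = (1 / n) *\<^sub>R (\<alpha> g (us ! (j - 1)) * (\<alpha> h (us ! (j - 1)))\<^sup>\<star>)" for j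
    by (simp add: b_def star_scaleR)
  then have "(\<Sum>j=1..length us. b j g * (b j h)\<^sup>\<star>) = (1 / n) *\<^sub>R (\<Sum>u\<leftarrow>us. \<alpha> g u * (\<alpha> h u)\<^sup>\<star>)"
    by (simp only: scaleR_sum_right[symmetric] sum_nth_eq_sum_list[of "\<lambda>u. \<alpha> g u * (\<alpha> h u)\<^sup>\<star>"])
  also have "(\<Sum>u\<leftarrow>us. \<alpha> g u * (\<alpha> h u)\<^sup>\<star>) = \<alpha> g (\<Sum>u\<leftarrow>us. u * \<alpha> (inv g \<otimes> h) (u\<^sup>\<star>))"
    using g h by (simp add: \<alpha>_sum_list \<alpha>_mult \<alpha>_comp \<alpha>_star m_assoc[symmetric])
  also have "\<dots> = \<alpha> g (n *\<^sub>R delta (inv g \<otimes> h))" using us g h by simp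
  also have "inv g \<otimes> h = \<one> \<longleftrightarrow> g = h"
    using g h by (metis inv_closed inv_equality inv_inv l_inv)
  then have "(1 / n) *\<^sub>R \<alpha> g (n *\<^sub>R delta (inv g \<otimes> h)) = (if g = h then 1 else 0)"
    using g h by (simp add: delta_def \<alpha>_scaleR)
  finally show "(\<Sum>j=1..length us. b j g * (b j h)\<^sup>\<star>) = (if g = h then 1 else 0)" .
qed

text \<open>The pairs of \<open>b j \<one>\<close> and its adjoint have coefficients \<Sum>
  \<open>b j \<one> * (\<alpha> g (b j \<one>))\<^sup>\<star>\<close>, where \<alpha> g of
  \<open>b j \<one>\<close> may be replaced by \<open>b j g\<close>. Since \<open>m\<close> depends
  on the precision, the elements \<open>b j \<one>\<close> need a bound independent of
  \<open>m\<close>; it comes from the diagonal case of the second condition.\<close>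

lemma approximable_delta_of_almost_covariant:
  assumes "\<forall>\<epsilon>>0. \<exists>m\<ge>1. \<exists>b :: nat \<Rightarrow> 'g \<Rightarrow> 'a. \<forall>g\<in>carrier G. \<forall>h\<in>carrier G.
    (\<Sum>j=1..m. norm (\<alpha> g (b j h) - b j (g \<otimes> h))) < \<epsilon> \<and>
    norm ((\<Sum>j=1..m. b j g * (b j h)\<^sup>\<star>) - (if g = h then 1 else 0)) < \<epsilon>"
  shows "approximable delta"
  unfolding approximable_def
proof (intro allI impI)
  fix \<epsilon> :: real assume "\<epsilon> > 0"
  \<comment> \<open>\<open>d \<le> 1\<close> gives the bound 2 on the elements
    \<open>b j \<one>\<close>; the total error is then \<open>2 * d\<close> from the replacement and
    \<open>d\<close> from orthogonality.\<close>
  define d where "d = min 1 (\<epsilon> / 3)"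
  have d: "d > 0" "d \<le> 1" "3 * d \<le> \<epsilon>" using \<open>\<epsilon> > 0\<close> by (auto simp: d_def)
  obtain m and b :: "nat \<Rightarrow> 'g \<Rightarrow> 'a" where
    b: "\<And>g h. g \<in> carrier G \<Longrightarrow> h \<in> carrier G \<Longrightarrow> (\<Sum>j=1..m. norm (\<alpha> g (b j h) - b j (g \<otimes> h))) < d"
      "\<And>g h. g \<in> carrier G \<Longrightarrow> h \<in> carrier G \<Longrightarrow>
        norm ((\<Sum>j=1..m. b j g * (b j h)\<^sup>\<star>) - (if g = h then 1 else 0)) < d"
    using assms[rule_format, OF d(1)] by blast
  let ?c = "\<lambda>j. b j \<one>"
  have c2: "norm (?c j) \<le> 2" if j: "j \<in> {1..m}" for j
  proof -
    let ?s = "\<Sum>j=1..m. ?c j * (?c j)\<^sup>\<star>"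
    have "cpositive (x * x\<^sup>\<star>)" for x :: 'a
      using cpositive_star_mult_self[of "x\<^sup>\<star>"] by (simp add: star_star)
    then have "norm (?c j * (?c j)\<^sup>\<star>) \<le> norm ?s"
      using j by (intro cpositive_sum_norm_le) auto
    also have "norm ?s \<le> norm (?s - 1) + norm (1::'a)"
      using norm_triangle_ineq[of "?s - 1" 1] by simp
    also have "\<dots> \<le> 2\<^sup>2" using b(2)[of \<one> \<one>] d(2) by simp
    finally have "(norm (?c j))\<^sup>2 \<le> 2\<^sup>2"
      using cstar_identity[of "(?c j)\<^sup>\<star>"] by (simp add: star_star)
    then show ?thesis by (rule power2_le_imp_le) simp
  qed
  let ?L = "map (\<lambda>j. (?c j, (?c j)\<^sup>\<star>)) [1..<Suc m]"
  have "norm (delta g - coef ?L g) < \<epsilon>" if g: "g \<in> carrier G" for g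
  proof -
    let ?t = "\<Sum>j=1..m. ?c j * (b j g)\<^sup>\<star>"
    have "coef ?L g = (\<Sum>j=1..m. ?c j * (\<alpha> g (?c j))\<^sup>\<star>)"
      using g by (simp add: coef_def comp_def interv_sum_list_conv_sum_set_nat
          atLeastLessThanSuc_atLeastAtMost \<alpha>_star del: upt_Suc)
    then have "coef ?L g - ?t = (\<Sum>j=1..m. ?c j * (\<alpha> g (?c j) - b j g)\<^sup>\<star>)"
      by (simp add: star_diff right_diff_distrib sum_subtractf)
    also have "norm \<dots> \<le> (\<Sum>j=1..m. 2 * norm (\<alpha> g (?c j) - b j g))"
    proof (rule sum_norm_le)
      fix j assume j: "j \<in> {1..m}"
      have "norm (?c j * (\<alpha> g (?c j) - b j g)\<^sup>\<star>) \<le> norm (?c j) * norm (\<alpha> g (?c j) - b j g)"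
        using norm_mult_ineq[of "?c j" "(\<alpha> g (?c j) - b j g)\<^sup>\<star>"] by simp
      also have "\<dots> \<le> 2 * norm (\<alpha> g (?c j) - b j g)"
        using c2[OF j] by (rule mult_right_mono) simp
      finally show "norm (?c j * (\<alpha> g (?c j) - b j g)\<^sup>\<star>) \<le> 2 * norm (\<alpha> g (?c j) - b j g)" .
    qed
    also have "\<dots> = 2 * (\<Sum>j=1..m. norm (\<alpha> g (?c j) - b j g))" by (rule sum_distrib_left[symmetric])
    also have "\<dots> < 2 * d" using b(1)[OF g one_closed] g by simp
    finally have 1: "norm (coef ?L g - ?t) < 2 * d" .
    have "(if \<one> = g then 1 else 0) = delta g" by (auto simp: delta_def)
    then have 2: "norm (?t - delta g) < d" using b(2)[OF one_closed g] by simp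
    have "norm (delta g - coef ?L g) \<le> norm (coef ?L g - ?t) + norm (?t - delta g)"
      using norm_triangle_ineq[of "coef ?L g - ?t" "?t - delta g"] by (simp add: norm_minus_commute)
    then show ?thesis using 1 2 d by linarith
  qed
  then show "\<exists>L. \<forall>g\<in>carrier G. norm (delta g - coef L g) < \<epsilon>" by blast
qed

end

theorem theorem4p1:
  fixes G :: "('g, 'r) monoid_scheme" (structure)
    and \<alpha> :: "'g \<Rightarrow> 'a \<Rightarrow> 'a::unital_cstar_algebra"
    and E :: "'a \<Rightarrow> 'a"
  assumes "group G" and "finite (carrier G)" and "cstar_action G \<alpha>"
    and E_def: "E = canonical_expectation G \<alpha>"
  shows
    "(saturated G \<alpha> \<longleftrightarrow>
        index_finite_type (fixed_point_algebra G \<alpha>) E \<and> Index E = of_nat (order G))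
     \<and>
     (saturated G \<alpha> \<longleftrightarrow>
        index_finite_type (fixed_point_algebra G \<alpha>) E \<and> Index E = of_nat (order G) \<and>
        (\<exists>n u. quasi_basis E n u \<and>
          (\<forall>g\<in>carrier G. g \<noteq> \<one> \<longrightarrow> (\<Sum>i=1..n. u i * \<alpha> g ((u i)\<^sup>\<star>)) = 0)))
     \<and>
     (saturated G \<alpha> \<longleftrightarrow>
        (\<exists>m\<ge>1. \<exists>b :: nat \<Rightarrow> 'g \<Rightarrow> 'a.
          (\<forall>j\<in>{1..m}. \<forall>g\<in>carrier G. \<forall>h\<in>carrier G. \<alpha> g (b j h) = b j (g \<otimes> h)) \<and>
          (\<forall>g\<in>carrier G. \<forall>h\<in>carrier G.
             (\<Sum>j=1..m. b j g * (b j h)\<^sup>\<star>) = (if g = h then 1 else 0))))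
     \<and>
     (saturated G \<alpha> \<longleftrightarrow>
        (\<forall>\<epsilon>>0. \<exists>m\<ge>1. \<exists>b :: nat \<Rightarrow> 'g \<Rightarrow> 'a. \<forall>g\<in>carrier G. \<forall>h\<in>carrier G.
          (\<Sum>j=1..m. norm (\<alpha> g (b j h) - b j (g \<otimes> h))) < \<epsilon> \<and>
          norm ((\<Sum>j=1..m. b j g * (b j h)\<^sup>\<star>) - (if g = h then 1 else 0)) < \<epsilon>))"
    (is "(?i \<longleftrightarrow> ?ii) \<and> (?i \<longleftrightarrow> ?iii) \<and> (?i \<longleftrightarrow> ?iv) \<and> (?i \<longleftrightarrow> ?v)")
proof -
  interpret finite_cstar_action G \<alpha>
    using assms by (simp add: finite_cstar_action_def finite_cstar_action_axioms_def)
  \<comment> \<open>In the crossed product this says that \<Sum> \<open>u e u\<^sup>\<star>\<close>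
    is the unit. Every implication back to saturation passes through it.\<close>
  define tight where "tight us \<longleftrightarrow> (\<forall>g\<in>carrier G. (\<Sum>u\<leftarrow>us. u * \<alpha> g (u\<^sup>\<star>)) = real (order G) *\<^sub>R delta g)" for us
  have tight_of_approximable: "\<exists>us. tight us" if "approximable delta"
    using tight_frame_of_approx that unfolding tight_def approximable_def by blast
  have i_tight: "\<exists>us. tight us" if ?i
    using that by (intro tight_of_approximable approximable_delta_of_saturated)
  have i_of_tight: ?i if "\<exists>us. tight us"
    using that unfolding tight_def by (elim exE) (rule saturated_of_tight_frame)
  have i_iii: ?iii if i: ?i
  proof -
    obtain us where t: "tight us" using i_tight[OF i] ..
    let ?u = "\<lambda>i. us ! (i - 1)"
    have q: "quasi_basis E (length us) ?u"
      unfolding E_def using t unfolding tight_def by (rule quasi_basis_of_tight_frame)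
    have sum: "(\<Sum>i=1..length us. ?u i * \<alpha> g ((?u i)\<^sup>\<star>)) = real (order G) *\<^sub>R delta g" if "g \<in> carrier G" for g
      using t that unfolding sum_nth_eq_sum_list[of "\<lambda>u. u * \<alpha> g (u\<^sup>\<star>)"] tight_def by blast
    have "Index E = of_nat (order G)"
      using Index_eq[OF q] sum[OF one_closed] by (simp add: delta_def scaleR_conv_of_real)
    moreover have "index_finite_type (fixed_point_algebra G \<alpha>) E"
      unfolding index_finite_type_def using q faithful_E E_def by blast
    moreover have "(\<Sum>i=1..length us. ?u i * \<alpha> g ((?u i)\<^sup>\<star>)) = 0" if "g \<in> carrier G" "g \<noteq> \<one>" for g
      using sum that by (simp add: delta_def)
    ultimately show ?iii using q by blast
  qed
  have iii_ii: ?ii if ?iii using that by blast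
  have ii_tight: "\<exists>us. tight us" if ?ii
    using that tight_frame_of_quasi_basis unfolding tight_def index_finite_type_def E_def by blast
  have i_iv: ?iv if ?i
    using i_tight[OF that] unfolding tight_def by (elim exE) (rule covariant_family_of_tight_frame)
  have iv_v: ?v if iv: ?iv
  proof (intro allI impI)
    fix \<epsilon> :: real assume "\<epsilon> > 0"
    obtain m and b :: "nat \<Rightarrow> 'g \<Rightarrow> 'a" where m: "m \<ge> 1"
      and b: "\<forall>j\<in>{1..m}. \<forall>g\<in>carrier G. \<forall>h\<in>carrier G. \<alpha> g (b j h) = b j (g \<otimes> h)"
        "\<forall>g\<in>carrier G. \<forall>h\<in>carrier G. (\<Sum>j=1..m. b j g * (b j h)\<^sup>\<star>) = (if g = h then 1 else 0)"
      using iv by blast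
    have "(\<Sum>j=1..m. norm (\<alpha> g (b j h) - b j (g \<otimes> h))) < \<epsilon> \<and>
        norm ((\<Sum>j=1..m. b j g * (b j h)\<^sup>\<star>) - (if g = h then 1 else 0)) < \<epsilon>"
      if "g \<in> carrier G" "h \<in> carrier G" for g h
      using b that \<open>\<epsilon> > 0\<close> by simp
    then show "\<exists>m\<ge>1. \<exists>b :: nat \<Rightarrow> 'g \<Rightarrow> 'a. \<forall>g\<in>carrier G. \<forall>h\<in>carrier G.
        (\<Sum>j=1..m. norm (\<alpha> g (b j h) - b j (g \<otimes> h))) < \<epsilon> \<and>
        norm ((\<Sum>j=1..m. b j g * (b j h)\<^sup>\<star>) - (if g = h then 1 else 0)) < \<epsilon>"
      using m by blast
  qed
  have v_tight: "\<exists>us. tight us" if ?v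
    using that by (intro tight_of_approximable approximable_delta_of_almost_covariant)
  have "?i \<longleftrightarrow> ?ii" by (rule iffI, erule iii_ii[OF i_iii], erule i_of_tight[OF ii_tight])
  moreover have "?i \<longleftrightarrow> ?iii" by (rule iffI, erule i_iii, erule i_of_tight[OF ii_tight[OF iii_ii]])
  moreover have "?i \<longleftrightarrow> ?iv" by (rule iffI, erule i_iv, erule i_of_tight[OF v_tight[OF iv_v]])
  moreover have "?i \<longleftrightarrow> ?v" by (rule iffI, erule iv_v[OF i_iv], erule i_of_tight[OF v_tight])
  ultimately show ?thesis by (intro conjI)
qed

end
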